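(* Let $G$ be a connected real Lie group and $X$ a metric space equipped with a proper $G$-action. Suppose $g_t$ is a non-trivial $\mathrm{Ad}$-diagonalizable (over $\mathbb R$) one-parameter subgroup of $G$ and $\varphi:[-1,1]\to\mathfrak g_\alpha$ is a $g_t$-admissible curve satisfying the $\beta$-contraction hypothesis on $X$, with height function $f$. Suppose $\delta\in[0,\beta)$ is fixed, and let $J_t:=[-e^{-\delta\alpha(t)},e^{-\delta\alpha(t)}]$. Then, for all $x_0\in X$ with $f(x_0)<\infty$, $$\sup_{\substack{t\ge0,\ s_0\in[-1,1]\\ J_t+s_0\subseteq[-1,1]}}\frac1{|J_t|}\int_{J_t+s_0}f(g_tu(\varphi(s))x_0)\,ds<\infty.$$ Moreover, for any $M>0$ the supremum can be taken to be uniform over base points $x_0\in\{f\le M\}$.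
   Context: $\mathfrak g=\mathrm{Lie}(G)$ decomposes into eigenspaces $\mathfrak g=\bigoplus_\alpha\mathfrak g_\alpha$ of $\mathrm{Ad}(g_t)$, where $\alpha$ ranges over additive homomorphisms $t\mapsto\alpha(t)$ and $\mathrm{Ad}(g_t)Y=e^{\alpha(t)}Y$ for $Y\in\mathfrak g_\alpha$. Write $u(Y)=\exp(Y)$; $|J|$ is the length of an interval $J$. A map $\varphi:[-1,1]\to\mathfrak g$ is $g_t$-admissible if: (a) $\varphi$ is $C^{1+\gamma}$ for some $\gamma>0$ (i.e. $C^1$ with $\gamma$-Hölder derivative); (b) its image is contained in a subspace $V$ of a single eigenspace $\mathfrak g_\alpha$ with $\alpha(t)>0$ for $t>0$ and $[V,V]=0$; (c) $\dot\varphi$ does not vanish on $[-1,1]$. A $g_t$-admissible curve $\varphi:[-1,1]\to\mathfrak g_\alpha$ satisfies the $\beta$-contraction hypothesis on $X$ if there is a proper (Borel measurable) function $f:X\to(0,\infty]$, called a height function, such that: 1. $\{f=\infty\}$ is $G$-invariant and $f$ is bounded on compact subsets of $X\setminus\{f=\infty\}$; 2. for every bounded neighborhood $\mathcal O$ of the identity in $G$ there is $C_{\mathcal O}\ge1$ with $C_{\mathcal O}^{-1}f(x)\le f(gx)\le C_{\mathcal O}f(x)$ for all $g\in\mathcal O$, $x\in X$; 3. there is $\tilde c\ge1$ such that for all $t>0$ there is $\tilde b=\tilde b(t)>0$ such that for all $x\in X$ and $s\in[-1,1]$, $\frac12\int_{-1}^1f(g_tu(r\dot\varphi(s))x)\,dr\le\tilde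 ce^{-\beta\alpha(t)}f(x)+\tilde b$; 4. for all $M\ge1$, the set $\overline{\{x\in X:f(x)\le M\}}$ is compact. *)

theory Defs
  imports "HOL-Analysis.Analysis" "HOL-Algebra.Group_Action"
begin

subsection \<open>Lie groups\<close>

text \<open>On an open subset of a finite-dimensional space this is the usual notion of $C^k$:
  all iterated directional derivatives up to order k exist as Frechet derivatives and are
  continuous.\<close>

primrec Ck_on :: "nat \<Rightarrow> ('a::real_normed_vector \<Rightarrow> 'b::real_normed_vector) \<Rightarrow> 'a set \<Rightarrow> bool" where
  "Ck_on 0 f S \<longleftrightarrow> continuous_on S f"
| "Ck_on (Suc k) f S \<longleftrightarrow> (\<forall>x\<in>S. f differentiable (at x)) \<and>
     (\<forall>v. Ck_on k (\<lambda>x. frechet_derivative f (at x) v) S)"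

definition smooth_on :: "('a::real_normed_vector \<Rightarrow> 'b::real_normed_vector) \<Rightarrow> 'a set \<Rightarrow> bool" where
  "smooth_on f S \<longleftrightarrow> (\<forall>k. Ck_on k f S)"

text \<open>A chart is a domain together with a coordinate map; the values of the coordinate map
  outside the domain are irrelevant.\<close>

type_synonym ('g, 'e) chart = "'g set \<times> ('g \<Rightarrow> 'e)"

abbreviation chart_dom :: "('g, 'e) chart \<Rightarrow> 'g set" where
  "chart_dom c \<equiv> fst c"

abbreviation chart_map :: "('g, 'e) chart \<Rightarrow> 'g \<Rightarrow> 'e" where
  "chart_map c \<equiv> snd c"

definition chart_inv :: "('g, 'e) chart \<Rightarrow> 'e \<Rightarrow> 'g" where
  "chart_inv c = inv_into (chart_dom c) (chart_map c)"

definition topological_chart :: "('g::topological_space, 'e::euclidean_space) chart \<Rightarrow> bool" where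
  "topological_chart c \<longleftrightarrow> open (chart_dom c) \<and> open (chart_map c ` chart_dom c) \<and>
     homeomorphism (chart_dom c) (chart_map c ` chart_dom c) (chart_map c) (chart_inv c)"

definition smooth_atlas :: "('g::topological_space, 'e::euclidean_space) chart set \<Rightarrow> bool" where
  "smooth_atlas A \<longleftrightarrow> (\<forall>c\<in>A. topological_chart c) \<and> (\<Union>c\<in>A. chart_dom c) = UNIV \<and>
     (\<forall>c\<in>A. \<forall>d\<in>A. smooth_on (chart_map d \<circ> chart_inv c) (chart_map c ` (chart_dom c \<inter> chart_dom d)))"

text \<open>The group is the whole type \<open>'g\<close>, which carries the (Hausdorff, second countable) topology.
  The model space \<open>'e\<close> has positive dimension; a zero-dimensional connected group is trivial and
  has no non-trivial one-parameter subgroup.\<close>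

locale lie_group = group G
  for G :: "'g::{t2_space, second_countable_topology} monoid" (structure) +
  fixes A :: "('g, 'e::euclidean_space) chart set"
  assumes carrier_UNIV: "carrier G = UNIV"
    and atlas: "smooth_atlas A"
    and continuous_mult: "continuous_on UNIV (\<lambda>(g, h). g \<otimes> h)"
    and continuous_inv: "continuous_on UNIV (\<lambda>g. inv g)"
    and smooth_mult: "\<And>b c d. \<lbrakk>b \<in> A; c \<in> A; d \<in> A\<rbrakk> \<Longrightarrow>
      smooth_on (\<lambda>(x, y). chart_map d (chart_inv b x \<otimes> chart_inv c y))
        {(x, y). x \<in> chart_map b ` chart_dom b \<and> y \<in> chart_map c ` chart_dom c \<and>
                 chart_inv b x \<otimes> chart_inv c y \<in> chart_dom d}"
    and smooth_inv: "\<And>c d. \<lbrakk>c \<in> A; d \<in> A\<rbrakk> \<Longrightarrow>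
      smooth_on (\<lambda>x. chart_map d (inv (chart_inv c x)))
        {x. x \<in> chart_map c ` chart_dom c \<and> inv (chart_inv c x) \<in> chart_dom d}"

subsection \<open>The Lie algebra\<close>

text \<open>\<open>chart_deriv c d F p\<close> is the differential of \<open>F\<close> at \<open>p\<close>, with tangent vectors at \<open>p\<close> written
  in the chart \<open>c\<close> and tangent vectors at \<open>F p\<close> written in the chart \<open>d\<close>.\<close>

definition chart_deriv ::
    "('g, 'e::euclidean_space) chart \<Rightarrow> ('g, 'e) chart \<Rightarrow> ('g \<Rightarrow> 'g) \<Rightarrow> 'g \<Rightarrow> 'e \<Rightarrow> 'e" where
  "chart_deriv c d F p = frechet_derivative (chart_map d \<circ> F \<circ> chart_inv c) (at (chart_map c p))"

text \<open>From here on \<open>c\<close> is a chart around the identity. The Lie algebra is the tangent space at the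
  identity, and the chart \<open>c\<close> identifies it, as a vector space, with the model space \<open>'e\<close>.
  The left-invariant vector field determined by \<open>v\<close> has at \<open>p\<close> the value $(dL_p)_e v$; below it
  is written in a chart \<open>d\<close> around \<open>p\<close>.\<close>

definition left_inv_field ::
    "'g monoid \<Rightarrow> ('g, 'e::euclidean_space) chart \<Rightarrow> 'e \<Rightarrow> ('g, 'e) chart \<Rightarrow> 'g \<Rightarrow> 'e" where
  "left_inv_field G c v d p = chart_deriv c d (\<lambda>h. p \<otimes>\<^bsub>G\<^esub> h) \<one>\<^bsub>G\<^esub> v"

text \<open>The bracket of \<open>v\<close> and \<open>w\<close> is the value at the identity of the commutator of the
  left-invariant vector fields; in coordinates $[V, W] = DW(V) - DV(W)$.\<close>

definition lie_bracket ::
    "'g monoid \<Rightarrow> ('g, 'e::euclidean_space) chart \<Rightarrow> 'e \<Rightarrow> 'e \<Rightarrow> 'e" where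
  "lie_bracket G c v w =
     (let x0 = chart_map c \<one>\<^bsub>G\<^esub>;
          V = (\<lambda>x. left_inv_field G c v c (chart_inv c x));
          W = (\<lambda>x. left_inv_field G c w c (chart_inv c x))
      in frechet_derivative W (at x0) (V x0) - frechet_derivative V (at x0) (W x0))"

definition Ad :: "'g monoid \<Rightarrow> ('g, 'e::euclidean_space) chart \<Rightarrow> 'g \<Rightarrow> 'e \<Rightarrow> 'e" where
  "Ad G c g = chart_deriv c c (\<lambda>h. g \<otimes>\<^bsub>G\<^esub> h \<otimes>\<^bsub>G\<^esub> inv\<^bsub>G\<^esub> g) \<one>\<^bsub>G\<^esub>"

text \<open>The integral curve through the identity of the left-invariant vector field of \<open>v\<close>.\<close>

definition is_exp_curve ::
    "'g::topological_space monoid \<Rightarrow> ('g, 'e::euclidean_space) chart set \<Rightarrow> ('g, 'e) chart \<Rightarrow>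
     'e \<Rightarrow> (real \<Rightarrow> 'g) \<Rightarrow> bool" where
  "is_exp_curve G A c v \<gamma> \<longleftrightarrow> \<gamma> 0 = \<one>\<^bsub>G\<^esub> \<and> continuous_on UNIV \<gamma> \<and>
     (\<forall>t. \<forall>d\<in>A. \<gamma> t \<in> chart_dom d \<longrightarrow>
        ((chart_map d \<circ> \<gamma>) has_vector_derivative left_inv_field G c v d (\<gamma> t)) (at t))"

definition lie_exp ::
    "'g::topological_space monoid \<Rightarrow> ('g, 'e::euclidean_space) chart set \<Rightarrow> ('g, 'e) chart \<Rightarrow>
     'e \<Rightarrow> 'g" where
  "lie_exp G A c v = (THE \<gamma>. is_exp_curve G A c v \<gamma>) 1"

subsection \<open>One-parameter subgroups and admissible curves\<close>

definition one_parameter_subgroup :: "'g::topological_space monoid \<Rightarrow> (real \<Rightarrow> 'g) \<Rightarrow> bool" where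
  "one_parameter_subgroup G g \<longleftrightarrow> continuous_on UNIV g \<and> (\<forall>s t. g (s + t) = g s \<otimes>\<^bsub>G\<^esub> g t)"

definition weight_space ::
    "'g monoid \<Rightarrow> ('g, 'e::euclidean_space) chart \<Rightarrow> (real \<Rightarrow> 'g) \<Rightarrow> (real \<Rightarrow> real) \<Rightarrow> 'e set" where
  "weight_space G c g \<alpha> = {Y. \<forall>t. Ad G c (g t) Y = exp (\<alpha> t) *\<^sub>R Y}"

text \<open>The sum of the weight spaces is automatically direct.\<close>

definition Ad_diagonalizable ::
    "'g monoid \<Rightarrow> ('g, 'e::euclidean_space) chart \<Rightarrow> (real \<Rightarrow> 'g) \<Rightarrow> bool" where
  "Ad_diagonalizable G c g \<longleftrightarrow> span (\<Union>\<alpha>\<in>{\<alpha>. Modules.additive \<alpha>}. weight_space G c g \<alpha>) = UNIV"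

text \<open>The derivative on $[-1,1]$, one-sided at the endpoints.\<close>

definition curve_deriv :: "(real \<Rightarrow> 'e::euclidean_space) \<Rightarrow> real \<Rightarrow> 'e" where
  "curve_deriv \<phi> s = vector_derivative \<phi> (at s within {-1..1})"

definition C1_Holder :: "real \<Rightarrow> (real \<Rightarrow> 'e::euclidean_space) \<Rightarrow> bool" where
  "C1_Holder \<gamma> \<phi> \<longleftrightarrow> (\<forall>s\<in>{-1..1}. \<phi> differentiable (at s within {-1..1})) \<and>
     (\<exists>C. \<forall>s\<in>{-1..1}. \<forall>r\<in>{-1..1}.
        norm (curve_deriv \<phi> s - curve_deriv \<phi> r) \<le> C * \<bar>s - r\<bar> powr \<gamma>)"

definition admissible ::
    "'g monoid \<Rightarrow> ('g, 'e::euclidean_space) chart \<Rightarrow> (real \<Rightarrow> 'g) \<Rightarrow> (real \<Rightarrow> real) \<Rightarrow>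
     (real \<Rightarrow> 'e) \<Rightarrow> bool" where
  "admissible G c g \<alpha> \<phi> \<longleftrightarrow>
     (\<exists>\<gamma>>0. C1_Holder \<gamma> \<phi>) \<and>
     Modules.additive \<alpha> \<and> (\<forall>t>0. \<alpha> t > 0) \<and>
     (\<exists>V. subspace V \<and> V \<subseteq> weight_space G c g \<alpha> \<and> \<phi> ` {-1..1} \<subseteq> V \<and>
          (\<forall>v\<in>V. \<forall>w\<in>V. lie_bracket G c v w = 0)) \<and>
     (\<forall>s\<in>{-1..1}. curve_deriv \<phi> s \<noteq> 0)"

subsection \<open>The contraction hypothesis\<close>

text \<open>Properness of an action in the sense that $(g, x) \mapsto (gx, x)$ is a proper map is not
  required: it fails for homogeneous spaces of a non-compact group by a lattice, and it is
  incompatible with a height function below (for $\beta > 0$) that takes a finite value. Every action that is proper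
  in that sense is in particular a continuous action as defined here.\<close>

definition continuous_action ::
    "'g::topological_space monoid \<Rightarrow> ('g \<Rightarrow> 'x::topological_space \<Rightarrow> 'x) \<Rightarrow> bool" where
  "continuous_action G act \<longleftrightarrow>
     group_action G UNIV act \<and> continuous_on UNIV (\<lambda>(g, x). act g x)"

text \<open>A neighbourhood in \<open>G\<close> is bounded if it is relatively compact. That the height function is
  proper is the last condition.\<close>

definition height_function ::
    "'g::topological_space monoid \<Rightarrow> ('g, 'e::euclidean_space) chart set \<Rightarrow> ('g, 'e) chart \<Rightarrow>
     ('g \<Rightarrow> 'x::metric_space \<Rightarrow> 'x) \<Rightarrow> (real \<Rightarrow> 'g) \<Rightarrow> (real \<Rightarrow> real) \<Rightarrow> (real \<Rightarrow> 'e) \<Rightarrow> real \<Rightarrow>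
     ('x \<Rightarrow> ennreal) \<Rightarrow> bool" where
  "height_function G A c act g \<alpha> \<phi> \<beta> f \<longleftrightarrow>
     f \<in> borel_measurable borel \<and> (\<forall>x. f x > 0) \<and>
     (\<forall>h x. f x = \<infinity> \<longrightarrow> f (act h x) = \<infinity>) \<and>
     (\<forall>K. compact K \<and> K \<subseteq> {x. f x \<noteq> \<infinity>} \<longrightarrow> (\<exists>B::real. \<forall>x\<in>K. f x \<le> ennreal B)) \<and>
     (\<forall>U. \<one>\<^bsub>G\<^esub> \<in> interior U \<and> compact (closure U) \<longrightarrow>
        (\<exists>C::real. C \<ge> 1 \<and> (\<forall>h\<in>U. \<forall>x. ennreal (inverse C) * f x \<le> f (act h x) \<and>
                                          f (act h x) \<le> ennreal C * f x))) \<and>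
     (\<exists>a::real. a \<ge> 1 \<and> (\<forall>t>0. \<exists>b::real. b > 0 \<and> (\<forall>x. \<forall>s\<in>{-1..1}.
        ennreal (1/2) * (\<integral>\<^sup>+r\<in>{-1..1}. f (act (g t \<otimes>\<^bsub>G\<^esub> lie_exp G A c (r *\<^sub>R curve_deriv \<phi> s)) x) \<partial>lborel)
          \<le> ennreal (a * exp (- \<beta> * \<alpha> t)) * f x + ennreal b))) \<and>
     (\<forall>M::real. M \<ge> 1 \<longrightarrow> compact (closure {x. f x \<le> ennreal M}))"

definition short_interval :: "real \<Rightarrow> (real \<Rightarrow> real) \<Rightarrow> real \<Rightarrow> real set" where
  "short_interval \<delta> \<alpha> t = {- exp (- \<delta> * \<alpha> t) .. exp (- \<delta> * \<alpha> t)}"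

text \<open>The supremum is over all \<open>t \<ge> 0\<close> and all centres \<open>s0\<close> whose interval lies in $[-1,1]$.\<close>

definition sup_average ::
    "'g::topological_space monoid \<Rightarrow> ('g, 'e::euclidean_space) chart set \<Rightarrow> ('g, 'e) chart \<Rightarrow>
     ('g \<Rightarrow> 'x \<Rightarrow> 'x) \<Rightarrow> (real \<Rightarrow> 'g) \<Rightarrow> (real \<Rightarrow> real) \<Rightarrow> (real \<Rightarrow> 'e) \<Rightarrow> real \<Rightarrow>
     ('x \<Rightarrow> ennreal) \<Rightarrow> 'x \<Rightarrow> ennreal" where
  "sup_average G A c act g \<alpha> \<phi> \<delta> f x0 =
     (SUP (t, s0) \<in> {(t, s0). t \<ge> 0 \<and> s0 \<in> {-1..1} \<and> (+) s0 ` short_interval \<delta> \<alpha> t \<subseteq> {-1..1}}.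
        (\<integral>\<^sup>+s\<in>(+) s0 ` short_interval \<delta> \<alpha> t. f (act (g t \<otimes>\<^bsub>G\<^esub> lie_exp G A c (\<phi> s)) x0) \<partial>lborel)
          / emeasure lborel (short_interval \<delta> \<alpha> t))"

end

theory Submission
  imports Defs
begin

text \<open>Write $u = \exp$ and let $\varepsilon = e^{-\alpha(t)}$. On $V$ the exponential map is a homomorphism, and
  $g_t u(v) g_{-t} = u(e^{\alpha(t)} v)$. By Taylor expansion of $\varphi$,
  $g_{t+\tau} u(\varphi(s + \varepsilon r)) = u(w) \, g_\tau u(r \dot\varphi(s)) \, g_t u(\varphi(s))$ with
  $|w| \le H e^{\alpha(\tau) - \gamma\alpha(t)}$, so for $t$ large in terms of $\tau$ the factor $u(w)$ costs a
  constant independent of $\tau$. Replacing an integral over an interval by the integral of its averages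
  at scale $\varepsilon$ and applying the contraction hypothesis, the supremum at time $t + \tau$ is at most
  $C e^{-(\beta-\delta)\alpha(\tau)}$ times the supremum at time $t$, plus a constant; for $\tau$ large the factor
  is at most one half. This needs $\varepsilon \le |J_t|$, that is $\delta \le 1$; for $\delta > 1$ the argument with
  exponent 1 already bounds $f$ pointwise, since $f$ varies by a bounded factor at scale $\varepsilon$.

  On the Lie group side everything rests on one fact: a curve whose left-translated velocity vanishes is
  constant. Applied to $\gamma_1\gamma_2^{-1}$ it gives uniqueness of one-parameter subgroups. If $[v,w] = 0$,
  then $\mathrm{Ad}(\exp(sv))w$ has zero derivative, so $\exp(sv)$ and $\exp(tw)$ commute.\<close>

subsection \<open>Second derivatives and ordinary differential equations\<close>

text \<open>What shapes the iteration is the order of the constants. One step of length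
  \<open>\<tau>\<close> multiplies the bound by the comparison constant \<open>C1\<close> and by the
  ratio of the lengths of J_t and J_{t+\<tau>}, which is e^{\<delta>\<alpha>(\<tau>)}. Hence
  \<open>C1\<close> has to be fixed before \<open>\<tau>\<close>; this is possible because the
  threshold \<open>t0\<close> is chosen after \<open>\<tau>\<close> and brings every error term into
  the unit ball of V. Times below \<open>t0 + \<tau>\<close> are covered by compactness. The bound
  is carried for all centres at once, since an interval enlarged by \<epsilon> on both sides is
  covered by two other intervals of the family. On the group side the calculus takes place mostly in
  one function, the multiplication m written in the chart \<open>c\<close>. Its derivative in the
  second slot gives left-invariant fields, in the first slot right-invariant ones, and
  \<open>Ad\<close> converts one kind into the other. The bracket is the antisymmetrised mixed
  second derivative of m. Symmetry of second derivatives is therefore what links [v,w] = 0 to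
  \<open>Ad\<close>, and a local existence theorem is what produces exponential curves from the
  definition by integral curves.\<close>

lemma second_difference_mean_value:
  fixes h A B :: "'a::real_normed_vector \<Rightarrow> real"
  assumes A: "\<And>x. x \<in> ball p r \<Longrightarrow> ((\<lambda>s. h (x + s *\<^sub>R a)) has_real_derivative A x) (at 0)"
    and B: "\<And>x. x \<in> ball p r \<Longrightarrow> ((\<lambda>s. A (x + s *\<^sub>R b)) has_real_derivative B x) (at 0)"
    and \<sigma>: "0 < \<sigma>" "\<sigma> * (norm a + norm b) < r"
  shows "\<exists>y\<in>ball p r. norm (y - p) \<le> \<sigma> * (norm a + norm b) \<and>
    h (p + \<sigma> *\<^sub>R a + \<sigma> *\<^sub>R b) - h (p + \<sigma> *\<^sub>R a) - h (p + \<sigma> *\<^sub>R b) + h p = \<sigma> * \<sigma> * B y"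
proof -
  have near: "norm (s *\<^sub>R a + t *\<^sub>R b) \<le> \<sigma> * (norm a + norm b)"
    if "0 \<le> s" "s \<le> \<sigma>" "0 \<le> t" "t \<le> \<sigma>" for s t
  proof -
    have "norm (s *\<^sub>R a + t *\<^sub>R b) \<le> s * norm a + t * norm b"
      using norm_triangle_ineq[of "s *\<^sub>R a" "t *\<^sub>R b"] that by simp
    also have "\<dots> \<le> \<sigma> * norm a + \<sigma> * norm b"
      using that by (intro add_mono mult_right_mono) auto
    finally show ?thesis by (simp add: algebra_simps)
  qed
  have inb: "p + s *\<^sub>R a + t *\<^sub>R b \<in> ball p r" if "0 \<le> s" "s \<le> \<sigma>" "0 \<le> t" "t \<le> \<sigma>" for s t
  proof -
    have "dist p (p + s *\<^sub>R a + t *\<^sub>R b) = norm (s *\<^sub>R a + t *\<^sub>R b)"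
      unfolding dist_norm by (subst norm_minus_commute) (simp add: algebra_simps)
    with near[OF that] \<sigma> show ?thesis by simp
  qed
  have shift: "(f has_real_derivative D) (at s)"
    if "((\<lambda>t. f (s + t)) has_real_derivative D) (at 0)" for f D and s :: real
    using DERIV_at_within_shift[of f D s 0 UNIV] that by simp
  \<comment> \<open>The double difference is \<open>H \<sigma> - H 0\<close>. One mean value theorem
    in the direction \<open>a\<close>, then one in the direction \<open>b\<close>, bring out the two
    factors \<open>\<sigma>\<close>.\<close>
  define H where "H s = h (p + s *\<^sub>R a + \<sigma> *\<^sub>R b) - h (p + s *\<^sub>R a)" for s
  have H: "(H has_real_derivative A (p + s *\<^sub>R a + \<sigma> *\<^sub>R b) - A (p + s *\<^sub>R a)) (at s)"
    if "0 \<le> s" "s \<le> \<sigma>" for s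
  proof (rule shift)
    have 1: "((\<lambda>t. h ((p + s *\<^sub>R a + \<sigma> *\<^sub>R b) + t *\<^sub>R a)) has_real_derivative A (p + s *\<^sub>R a + \<sigma> *\<^sub>R b)) (at 0)"
      using inb[of s \<sigma>] that \<sigma> by (intro A) auto
    have 2: "((\<lambda>t. h ((p + s *\<^sub>R a) + t *\<^sub>R a)) has_real_derivative A (p + s *\<^sub>R a)) (at 0)"
      using inb[of s 0] that \<sigma> by (intro A) auto
    show "((\<lambda>t. H (s + t)) has_real_derivative A (p + s *\<^sub>R a + \<sigma> *\<^sub>R b) - A (p + s *\<^sub>R a)) (at 0)"
      using DERIV_diff[OF 1 2] by (simp add: H_def algebra_simps)
  qed
  obtain \<xi> where \<xi>: "0 < \<xi>" "\<xi> < \<sigma>"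
    "H \<sigma> - H 0 = (\<sigma> - 0) * (A (p + \<xi> *\<^sub>R a + \<sigma> *\<^sub>R b) - A (p + \<xi> *\<^sub>R a))"
    using MVT2[OF \<sigma>(1) H] by auto
  have K: "((\<lambda>t. A (p + \<xi> *\<^sub>R a + t *\<^sub>R b)) has_real_derivative B (p + \<xi> *\<^sub>R a + t *\<^sub>R b)) (at t)"
    if "0 \<le> t" "t \<le> \<sigma>" for t
  proof (rule shift)
    have "((\<lambda>u. A ((p + \<xi> *\<^sub>R a + t *\<^sub>R b) + u *\<^sub>R b)) has_real_derivative B (p + \<xi> *\<^sub>R a + t *\<^sub>R b)) (at 0)"
      using inb[of \<xi> t] that \<xi> by (intro B) auto
    then show "((\<lambda>u. A (p + \<xi> *\<^sub>R a + (t + u) *\<^sub>R b)) has_real_derivative B (p + \<xi> *\<^sub>R a + t *\<^sub>R b)) (at 0)"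
      by (simp add: algebra_simps)
  qed
  obtain \<eta> where \<eta>: "0 < \<eta>" "\<eta> < \<sigma>"
    "A (p + \<xi> *\<^sub>R a + \<sigma> *\<^sub>R b) - A (p + \<xi> *\<^sub>R a + 0 *\<^sub>R b) = (\<sigma> - 0) * B (p + \<xi> *\<^sub>R a + \<eta> *\<^sub>R b)"
    using MVT2[OF \<sigma>(1) K] by auto
  let ?y = "p + \<xi> *\<^sub>R a + \<eta> *\<^sub>R b"
  have "norm (?y - p) \<le> \<sigma> * (norm a + norm b)"
    using near[of \<xi> \<eta>] \<xi> \<eta> by (simp add: add.assoc)
  moreover have "?y \<in> ball p r" using inb \<xi> \<eta> by simp
  moreover have "h (p + \<sigma> *\<^sub>R a + \<sigma> *\<^sub>R b) - h (p + \<sigma> *\<^sub>R a) - h (p + \<sigma> *\<^sub>R b) + h p = H \<sigma> - H 0"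
    by (simp add: H_def)
  ultimately show ?thesis using \<xi>(3) \<eta>(3) by (intro bexI[of _ ?y]) (auto simp: mult.assoc)
qed

lemma frechet_derivative_line:
  assumes "f differentiable (at x)"
  shows "((\<lambda>s. f (x + s *\<^sub>R a)) has_vector_derivative frechet_derivative f (at x) a) (at 0)"
proof -
  have f: "(f has_derivative frechet_derivative f (at x)) (at (x + 0 *\<^sub>R a))"
    using assms by (simp add: frechet_derivative_works[symmetric])
  have l: "((\<lambda>s. x + s *\<^sub>R a) has_derivative (\<lambda>s. s *\<^sub>R a)) (at 0)"
    by (auto intro!: derivative_eq_intros)
  have "linear (frechet_derivative f (at x))"
    using assms by (rule linear_frechet_derivative)
  then show ?thesis
    using diff_chain_at[OF l f] by (simp add: has_vector_derivative_def o_def linear_scale)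
qed

lemma Ck_on_2D:
  assumes "Ck_on (Suc (Suc 0)) f S"
  shows "\<And>x. x \<in> S \<Longrightarrow> f differentiable (at x)"
    and "\<And>x v. x \<in> S \<Longrightarrow> (\<lambda>x. frechet_derivative f (at x) v) differentiable (at x)"
    and "\<And>v. continuous_on S (\<lambda>x. frechet_derivative f (at x) v)"
    and "\<And>v w. continuous_on S (\<lambda>x. frechet_derivative (\<lambda>x. frechet_derivative f (at x) v) (at x) w)"
  using assms
  by (auto intro!: continuous_at_imp_continuous_on differentiable_imp_continuous_within)

text \<open>The second difference over a parallelogram is symmetric in its sides, so it equals
  \<open>\<sigma> * \<sigma>\<close> times either mixed derivative, each taken at some nearby point;
  continuity at \<open>p\<close> then identifies the two. Coordinates are treated separately because
  the mean value theorem needs real values.\<close>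

lemma frechet_derivative_commute:
  fixes f :: "'a::real_normed_vector \<Rightarrow> 'b::euclidean_space"
  assumes C2: "Ck_on (Suc (Suc 0)) f S" and S: "open S" "p \<in> S"
  shows "frechet_derivative (\<lambda>x. frechet_derivative f (at x) a) (at p) b =
         frechet_derivative (\<lambda>x. frechet_derivative f (at x) b) (at p) a"
proof (rule euclidean_eqI)
  fix k :: 'b assume "k \<in> Basis"
  note C = Ck_on_2D[OF C2]
  define h where "h x = f x \<bullet> k" for x
  define D where "D a x = frechet_derivative f (at x) a \<bullet> k" for a x
  define DD where "DD a b x = frechet_derivative (\<lambda>x. frechet_derivative f (at x) a) (at x) b \<bullet> k" for a b x
  have D: "((\<lambda>s. h (x + s *\<^sub>R a)) has_real_derivative D a x) (at 0)" if "x \<in> S" for x a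
    unfolding h_def D_def has_real_derivative_iff_has_vector_derivative
    by (intro bounded_linear.has_vector_derivative[OF bounded_linear_inner_left]
        frechet_derivative_line C that)
  have DD: "((\<lambda>s. D a (x + s *\<^sub>R b)) has_real_derivative DD a b x) (at 0)" if "x \<in> S" for x a b
    unfolding DD_def D_def has_real_derivative_iff_has_vector_derivative
    by (intro bounded_linear.has_vector_derivative[OF bounded_linear_inner_left]
        frechet_derivative_line C that)
  have cont: "continuous (at p) (DD a b)" for a b
  proof -
    have "continuous_on S (DD a b)" unfolding DD_def by (intro continuous_intros C)
    then show ?thesis using S continuous_on_eq_continuous_at by blast
  qed
  have "\<bar>DD a b p - DD b a p\<bar> \<le> e" if e: "e > 0" for e
  proof -
    have e2: "e / 2 > 0" using e by simp
    obtain r0 where r0: "r0 > 0" "ball p r0 \<subseteq> S" using S openE by blast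
    obtain r1 where r1: "r1 > 0" "\<And>y. dist y p < r1 \<Longrightarrow> dist (DD a b y) (DD a b p) < e/2"
      using cont[of a b, unfolded continuous_at_eps_delta] e2 by blast
    obtain r2 where r2: "r2 > 0" "\<And>y. dist y p < r2 \<Longrightarrow> dist (DD b a y) (DD b a p) < e/2"
      using cont[of b a, unfolded continuous_at_eps_delta] e2 by blast
    define r where "r = min r0 (min r1 r2)"
    have r: "r > 0" "ball p r \<subseteq> S" using r0 r1 r2 by (auto simp: r_def)
    \<comment> \<open>This keeps the parallelogram inside the ball of radius \<open>r\<close>; the
      summand 1 covers \<open>a = b = 0\<close>.\<close>
    define \<sigma> where "\<sigma> = r / (2 * (norm a + norm b + 1))"
    have pos: "norm a + norm b + 1 > 0" by (smt (verit) norm_ge_zero)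
    have \<sigma>: "\<sigma> > 0" using r pos by (simp add: \<sigma>_def)
    have "\<sigma> * (norm a + norm b) \<le> \<sigma> * (norm a + norm b + 1)" using \<sigma> by simp
    also have "\<dots> = r / 2" using pos by (simp add: \<sigma>_def field_simps)
    finally have small: "\<sigma> * (norm a + norm b) < r" using r by simp
    have mv: "\<exists>y. norm (y - p) \<le> \<sigma> * (norm a + norm b) \<and>
      h (p + \<sigma> *\<^sub>R a + \<sigma> *\<^sub>R b) - h (p + \<sigma> *\<^sub>R a) - h (p + \<sigma> *\<^sub>R b) + h p = \<sigma> * \<sigma> * DD a b y"
      if "\<sigma> * (norm a + norm b) < r" for a b
    proof -
      have "\<exists>y\<in>ball p r. norm (y - p) \<le> \<sigma> * (norm a + norm b) \<and>
        h (p + \<sigma> *\<^sub>R a + \<sigma> *\<^sub>R b) - h (p + \<sigma> *\<^sub>R a) - h (p + \<sigma> *\<^sub>R b) + h p = \<sigma> * \<sigma> * DD a b y"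
      proof (rule second_difference_mean_value[where A = "D a"])
        show "((\<lambda>s. h (x + s *\<^sub>R a)) has_real_derivative D a x) (at 0)" if "x \<in> ball p r" for x
          by (rule D) (use that r(2) in auto)
        show "((\<lambda>s. D a (x + s *\<^sub>R b)) has_real_derivative DD a b x) (at 0)" if "x \<in> ball p r" for x
          by (rule DD) (use that r(2) in auto)
      qed (fact \<sigma> that)+
      then show ?thesis by blast
    qed
    obtain y where y: "norm (y - p) \<le> \<sigma> * (norm a + norm b)"
      "h (p + \<sigma> *\<^sub>R a + \<sigma> *\<^sub>R b) - h (p + \<sigma> *\<^sub>R a) - h (p + \<sigma> *\<^sub>R b) + h p = \<sigma> * \<sigma> * DD a b y"
      using mv[OF small] by blast
    have small': "\<sigma> * (norm b + norm a) < r" using small by (simp add: add.commute)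
    obtain z where z: "norm (z - p) \<le> \<sigma> * (norm b + norm a)"
      "h (p + \<sigma> *\<^sub>R b + \<sigma> *\<^sub>R a) - h (p + \<sigma> *\<^sub>R b) - h (p + \<sigma> *\<^sub>R a) + h p = \<sigma> * \<sigma> * DD b a z"
      using mv[OF small'] by blast
    have "\<sigma> * \<sigma> * DD a b y = \<sigma> * \<sigma> * DD b a z"
      using y(2) z(2) by (simp add: algebra_simps)
    then have eq: "DD a b y = DD b a z" using \<sigma> by simp
    have "dist y p < r" "dist z p < r"
      unfolding dist_norm using y(1) z(1) small small' by linarith+
    then have "dist y p < r1" "dist z p < r2" by (simp_all add: r_def)
    from r1(2)[OF this(1)] r2(2)[OF this(2)] eq show ?thesis
      unfolding dist_real_def by linarith
  qed
  then have "\<bar>DD a b p - DD b a p\<bar> \<le> 0" by (rule field_le_epsilon) simp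
  then have "DD a b p = DD b a p" by simp
  then show "frechet_derivative (\<lambda>x. frechet_derivative f (at x) a) (at p) b \<bullet> k =
         frechet_derivative (\<lambda>x. frechet_derivative f (at x) b) (at p) a \<bullet> k"
    by (simp add: DD_def)
qed

section \<open>Local existence of integral curves\<close>

lemma C1_imp_lipschitz_on_cball:
  fixes X :: "'a::euclidean_space \<Rightarrow> 'b::real_normed_vector"
  assumes C1: "Ck_on (Suc 0) X S" and S: "open S" "x0 \<in> S"
  shows "\<exists>r>0. \<exists>L. cball x0 r \<subseteq> S \<and> L-lipschitz_on (cball x0 r) X"
proof -
  obtain r where r: "r > 0" "cball x0 r \<subseteq> S" using S open_contains_cball by blast
  \<comment> \<open>\<open>Ck_on\<close> makes each directional derivative continuous, not the
    operator norm. A finite sum over the basis dominates that norm and is bounded on the compact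
    ball.\<close>
  let ?F = "\<lambda>x. \<Sum>b\<in>Basis. norm (frechet_derivative X (at x) b)"
  have "continuous_on (cball x0 r) ?F"
    using C1 r by (auto intro!: continuous_intros intro: continuous_on_subset)
  then have "bounded (?F ` cball x0 r)"
    by (intro compact_imp_bounded compact_continuous_image) auto
  then obtain L where L: "\<And>x. x \<in> cball x0 r \<Longrightarrow> norm (?F x) \<le> L" "L > 0"
    unfolding bounded_pos by blast
  have "L-lipschitz_on (cball x0 r) X"
  proof (rule lipschitz_onI)
    fix x y assume xy: "x \<in> cball x0 r" "y \<in> cball x0 r"
    have "norm (X x - X y) \<le> L * norm (x - y)"
    proof (rule differentiable_bound[OF convex_cball _ _ xy])
      fix z assume z: "z \<in> cball x0 r"
      then have d: "X differentiable (at z)" using C1 r by auto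
      then show "(X has_derivative frechet_derivative X (at z)) (at z within cball x0 r)"
        by (simp add: frechet_derivative_works[symmetric] has_derivative_at_withinI)
      have "onorm (frechet_derivative X (at z)) \<le> ?F z"
        by (rule onorm_componentwise) (use d frechet_derivative_works has_derivative_bounded_linear in blast)
      also have "\<dots> \<le> L" using L(1)[OF z] by simp
      finally show "onorm (frechet_derivative X (at z)) \<le> L" .
    qed
    then show "dist (X x) (X y) \<le> L * dist x y" by (simp add: dist_norm)
  qed (use L in auto)
  with r show ?thesis by blast
qed

text \<open>Banach's fixed point theorem in the space of bounded continuous functions on the whole
  line. Time is clamped to [-\<epsilon>,\<epsilon>] by \<open>cl\<close>, so the solution is a
  global continuous curve inside the ball, although it solves the equation only near 0; curves in
  the group are later required to be continuous on \<open>UNIV\<close>.\<close>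

lemma picard_local_solution:
  fixes X :: "'a::euclidean_space \<Rightarrow> 'a"
  assumes r: "r > 0" and lip: "L-lipschitz_on (cball x0 r) X"
  shows "\<exists>\<epsilon>>0. \<exists>x. x 0 = x0 \<and> continuous_on UNIV x \<and> (\<forall>t. x t \<in> cball x0 r) \<and>
    (\<forall>t\<in>{-\<epsilon><..<\<epsilon>}. (x has_vector_derivative X (x t)) (at t))"
proof -
  have contX: "continuous_on (cball x0 r) X" using lip by (rule lipschitz_on_continuous_on)
  have "bounded (X ` cball x0 r)"
    by (intro compact_imp_bounded compact_continuous_image contX) auto
  then obtain M where M: "\<And>y. y \<in> cball x0 r \<Longrightarrow> norm (X y) \<le> M" "M > 0"
    unfolding bounded_pos by blast
  have L: "L \<ge> 0" using lip by (rule lipschitz_on_nonneg)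
  \<comment> \<open>Two integrals, over lengths at most 2\<epsilon> and \<epsilon>, are estimated
    separately, whence the factor 3: \<open>3 * \<epsilon> * M \<le> r\<close> keeps the iterates in
    the ball and \<open>3 * \<epsilon> * L \<le> 1/2\<close> makes \<open>T\<close> a
    contraction.\<close>
  define \<epsilon> where "\<epsilon> = min (r / (3 * M)) (1 / (6 * (L + 1)))"
  have \<epsilon>: "\<epsilon> > 0" using r M L by (simp add: \<epsilon>_def)
  have "\<epsilon> \<le> r / (3 * M)" unfolding \<epsilon>_def by simp
  then have \<epsilon>M: "3 * \<epsilon> * M \<le> r" using M by (simp add: field_simps)
  have "\<epsilon> \<le> 1 / (6 * (L + 1))" unfolding \<epsilon>_def by simp
  then have "6 * \<epsilon> * (L + 1) \<le> 1" using L by (simp add: field_simps)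
  then have \<epsilon>L: "3 * \<epsilon> * L \<le> 1/2" using \<epsilon> by (simp add: algebra_simps)
  define cl where "cl t = max (-\<epsilon>) (min \<epsilon> t)" for t :: real
  have cl: "cl t \<in> {-\<epsilon>..\<epsilon>}" for t using \<epsilon> by (auto simp: cl_def)
  have cl0: "0 \<in> {-\<epsilon>..\<epsilon>}" using \<epsilon> by auto
  have ccl: "continuous_on UNIV cl" unfolding cl_def by (intro continuous_intros)
  \<comment> \<open>An integral over \<open>{0..t}\<close> would be zero for negative
    \<open>t\<close>. Starting at \<open>-\<epsilon>\<close> and subtracting the value at 0 treats
    both signs of \<open>t\<close> alike.\<close>
  define I where "I x t = integral {-\<epsilon>..t} (\<lambda>s. X (x s))" for x t
  define T where "T x t = x0 + (I x (cl t) - I x 0)" for x t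
  define S :: "(real \<Rightarrow>\<^sub>C 'a) set" where "S = PiC UNIV (\<lambda>_. cball x0 r)"
  have S: "x \<in> S \<longleftrightarrow> (\<forall>t. apply_bcontfun x t \<in> cball x0 r)" for x
    unfolding S_def mem_PiC_iff by auto
  have cX: "continuous_on A (\<lambda>s. X (apply_bcontfun x s))" if "x \<in> S" for x A
    by (rule continuous_on_compose2[OF contX]) (use that S in auto)
  have Iint: "(\<lambda>s. X (apply_bcontfun x s)) integrable_on {-\<epsilon>..t}" if "x \<in> S" for x t
    using cX[OF that] by (rule integrable_continuous_real)
  have Ibound: "norm (I x t) \<le> M * (t + \<epsilon>)" if "x \<in> S" "t \<in> {-\<epsilon>..\<epsilon>}" for x t
    using integral_bound[of "-\<epsilon>" t "\<lambda>s. X (x s)" M] cX that M S by (auto simp: I_def)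
  have Tball: "T x t \<in> cball x0 r" if "x \<in> S" for x t
  proof -
    have "norm (I x (cl t)) \<le> M * (cl t + \<epsilon>)" "norm (I x 0) \<le> M * (0 + \<epsilon>)"
      using Ibound that cl cl0 by blast+
    moreover have "M * (cl t + \<epsilon>) \<le> M * (2 * \<epsilon>)" using cl[of t] M by (intro mult_left_mono) auto
    ultimately have "norm (I x (cl t) - I x 0) \<le> 3 * \<epsilon> * M"
      using norm_triangle_ineq4[of "I x (cl t)" "I x 0"] by (simp add: algebra_simps)
    then show ?thesis using \<epsilon>M by (simp add: T_def dist_norm norm_minus_commute[of "I x 0"])
  qed
  have Tcont: "continuous_on UNIV (T x)" if "x \<in> S" for x
  proof -
    have "continuous_on {-\<epsilon>..\<epsilon>} (I x)"
      unfolding I_def by (rule indefinite_integral_continuous_1[OF Iint[OF that]])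
    then have "continuous_on UNIV (\<lambda>t. I x (cl t))"
      by (rule continuous_on_compose2[OF _ ccl]) (use cl in auto)
    then show ?thesis unfolding T_def by (intro continuous_intros)
  qed
  have Tb: "T x \<in> bcontfun" if "x \<in> S" for x
  proof -
    have "range (T x) \<subseteq> cball x0 r" using Tball[OF that] by auto
    then show ?thesis using Tcont[OF that] bounded_subset[OF bounded_cball]
      by (auto simp: bcontfun_def)
  qed
  define T' where "T' x = Bcontfun (T x)" for x :: "real \<Rightarrow>\<^sub>C 'a"
  have T': "apply_bcontfun (T' x) = T x" if "x \<in> S" for x
    unfolding T'_def using Tb[OF that] by (rule Bcontfun_inverse)
  have "\<exists>!x\<in>S. T' x = x"
  proof (rule Banach_fix)
    have "closed S" unfolding S_def by (rule closed_PiC) auto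
    then show "complete S" by (simp add: complete_eq_closed)
    have "const_bcontfun x0 \<in> S" using r by (simp add: S const_bcontfun.rep_eq)
    then show "S \<noteq> {}" by auto
    show "T' ` S \<subseteq> S" using Tball T' S by auto
    fix x y assume x: "x \<in> S" and y: "y \<in> S"
    let ?d = "dist x y"
    have Idiff: "norm (I x t - I y t) \<le> L * ?d * (t + \<epsilon>)" if "t \<in> {-\<epsilon>..\<epsilon>}" for t
    proof -
      have "norm (X (x s) - X (y s)) \<le> L * ?d" for s
      proof -
        have "dist (X (x s)) (X (y s)) \<le> L * dist (x s) (y s)"
          using lipschitz_onD[OF lip] x y S by blast
        also have "\<dots> \<le> L * ?d" using L by (intro mult_left_mono dist_bounded)
        finally show ?thesis by (simp add: dist_norm)
      qed
      then have "norm (integral {-\<epsilon>..t} (\<lambda>s. X (x s) - X (y s))) \<le> L * ?d * (t - - \<epsilon>)"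
        using that by (intro integral_bound continuous_intros cX x y) auto
      moreover have "integral {-\<epsilon>..t} (\<lambda>s. X (x s) - X (y s)) = I x t - I y t"
        unfolding I_def by (rule Henstock_Kurzweil_Integration.integral_diff[OF Iint[OF x] Iint[OF y]])
      ultimately show ?thesis by simp
    qed
    show "dist (T' x) (T' y) \<le> 1/2 * ?d"
    proof (rule dist_bound)
      fix t
      have "dist (T x t) (T y t) = norm ((I x (cl t) - I y (cl t)) - (I x 0 - I y 0))"
        by (simp add: T_def dist_norm algebra_simps)
      also have "\<dots> \<le> norm (I x (cl t) - I y (cl t)) + norm (I x 0 - I y 0)"
        by (rule norm_triangle_ineq4)
      also have "\<dots> \<le> L * ?d * (cl t + \<epsilon>) + L * ?d * (0 + \<epsilon>)"
        using Idiff cl cl0 by (intro add_mono) blast+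
      also have "\<dots> \<le> L * ?d * (\<epsilon> + \<epsilon>) + L * ?d * (0 + \<epsilon>)"
        using cl[of t] L by (intro add_mono mult_left_mono) auto
      also have "\<dots> = (3 * \<epsilon> * L) * ?d" by (simp add: algebra_simps)
      also have "\<dots> \<le> 1/2 * ?d" using \<epsilon>L by (intro mult_right_mono) auto
      finally show "dist (T' x t) (T' y t) \<le> 1/2 * ?d" by (simp add: T' x y)
    qed
  qed auto
  then obtain x where x: "x \<in> S" "T' x = x" by blast
  have fp: "apply_bcontfun x t = T x t" for t using T'[OF x(1)] x(2) by simp
  have "apply_bcontfun x 0 = x0" using \<epsilon> by (simp add: fp T_def cl_def)
  moreover have "(x has_vector_derivative X (x t)) (at t)" if t: "t \<in> {-\<epsilon><..<\<epsilon>}" for t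
  proof -
    have "(I x has_vector_derivative X (x t)) (at t within {-\<epsilon>..\<epsilon>})"
      unfolding I_def using cX[OF x(1)] t
      by (intro integral_has_vector_derivative[where f = "\<lambda>s. X (x s)"]) auto
    then have "(I x has_vector_derivative X (x t)) (at t)"
      using t at_within_interior[of t "{-\<epsilon>..\<epsilon>}"] by simp
    then have "((\<lambda>t. x0 + (I x t - I x 0)) has_vector_derivative X (x t)) (at t)"
      by (auto intro!: derivative_eq_intros)
    then show ?thesis
    proof (rule has_vector_derivative_transform_within_open[OF _ open_greaterThanLessThan t])
      fix s assume "s \<in> {-\<epsilon><..<\<epsilon>}"
      then show "x0 + (I x s - I x 0) = x s" by (simp add: fp[of s] T_def cl_def)
    qed
  qed
  ultimately show ?thesis
    using \<epsilon> x(1) S by (intro exI[of _ \<epsilon>] conjI exI[of _ "apply_bcontfun x"]) auto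
qed

subsection \<open>Velocities of curves\<close>

context lie_group begin

lemma in_carrier [simp]: "x \<in> carrier G"
  by (simp add: carrier_UNIV)

lemma mult_inv_cancel [simp]:
  "inv x \<otimes> (x \<otimes> y) = y" "x \<otimes> (inv x \<otimes> y) = y"
  by (simp_all flip: m_assoc)

lemma continuous_on_mult_group [continuous_intros]:
  assumes "continuous_on S f" "continuous_on S h"
  shows "continuous_on S (\<lambda>s. f s \<otimes> h s)"
  using continuous_on_compose2[OF continuous_mult continuous_on_Pair[OF assms]] by simp

lemma continuous_on_inv_group [continuous_intros]:
  "continuous_on S f \<Longrightarrow> continuous_on S (\<lambda>s. inv (f s))"
  by (rule continuous_on_compose2[OF continuous_inv]) auto

lemma chart_props:
  assumes "d \<in> A"
  shows "open (chart_dom d)" "open (chart_map d ` chart_dom d)"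
    "continuous_on (chart_dom d) (chart_map d)"
    "continuous_on (chart_map d ` chart_dom d) (chart_inv d)"
    "\<And>p. p \<in> chart_dom d \<Longrightarrow> chart_inv d (chart_map d p) = p"
    "\<And>x. x \<in> chart_map d ` chart_dom d \<Longrightarrow> chart_inv d x \<in> chart_dom d"
    "\<And>x. x \<in> chart_map d ` chart_dom d \<Longrightarrow> chart_map d (chart_inv d x) = x"
  using atlas assms unfolding smooth_atlas_def topological_chart_def homeomorphism_def by auto

lemma chart_exists: obtains d where "d \<in> A" "p \<in> chart_dom d"
proof -
  have "p \<in> (\<Union>d\<in>A. chart_dom d)" using atlas unfolding smooth_atlas_def by blast
  then show thesis using that by blast
qed

lemma chart_map_eq_iff:
  "d \<in> A \<Longrightarrow> p \<in> chart_dom d \<Longrightarrow> q \<in> chart_dom d \<Longrightarrow> chart_map d p = chart_map d q \<longleftrightarrow> p = q"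
  by (metis chart_props(5))

lemma open_chart_preimage:
  assumes "b \<in> A" "d \<in> A" "continuous_on UNIV F"
  shows "open {x \<in> chart_map b ` chart_dom b. F (chart_inv b x) \<in> chart_dom d}"
proof -
  have "continuous_on (chart_map b ` chart_dom b) (\<lambda>x. F (chart_inv b x))"
    by (rule continuous_on_compose2[OF assms(3) chart_props(4)[OF assms(1)]]) simp
  then have "open ((\<lambda>x. F (chart_inv b x)) -` chart_dom d \<inter> chart_map b ` chart_dom b)"
    using chart_props(1)[OF assms(2)] continuous_on_open_vimage[OF chart_props(2)[OF assms(1)]] by blast
  moreover have "(\<lambda>x. F (chart_inv b x)) -` chart_dom d \<inter> chart_map b ` chart_dom b =
      {x \<in> chart_map b ` chart_dom b. F (chart_inv b x) \<in> chart_dom d}" by blast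
  ultimately show ?thesis by simp
qed

text \<open>\<open>chart_deriv\<close> yields some map even where no derivative exists. The
  relational form carries differentiability with it, so chain rules can be composed and derivatives
  compared by uniqueness.\<close>

definition has_chart_deriv ::
    "('g, 'e) chart \<Rightarrow> ('g, 'e) chart \<Rightarrow> ('g \<Rightarrow> 'g) \<Rightarrow> 'g \<Rightarrow> ('e \<Rightarrow> 'e) \<Rightarrow> bool" where
  "has_chart_deriv b d F p D \<longleftrightarrow> ((chart_map d \<circ> F \<circ> chart_inv b) has_derivative D) (at (chart_map b p))"

lemma has_chart_deriv_imp_eq: "has_chart_deriv b d F p D \<Longrightarrow> chart_deriv b d F p = D"
  unfolding has_chart_deriv_def chart_deriv_def by (rule frechet_derivative_at[symmetric])

lemma has_chart_deriv_linear: "has_chart_deriv b d F p D \<Longrightarrow> bounded_linear D"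
  unfolding has_chart_deriv_def by (rule has_derivative_bounded_linear)

lemma has_chart_deriv_comp:
  assumes A: "b \<in> A" "d \<in> A" and F: "has_chart_deriv b d F p D" and H: "has_chart_deriv d e H (F p) D'"
    and c: "continuous_on UNIV F" and p: "p \<in> chart_dom b" "F p \<in> chart_dom d"
  shows "has_chart_deriv b e (H \<circ> F) p (D' \<circ> D)"
proof -
  let ?f = "chart_map d \<circ> F \<circ> chart_inv b" and ?h = "chart_map e \<circ> H \<circ> chart_inv d"
  let ?O = "{x \<in> chart_map b ` chart_dom b. F (chart_inv b x) \<in> chart_dom d}"
  have "?f (chart_map b p) = chart_map d (F p)" using p A by (simp add: chart_props)
  then have "(?h \<circ> ?f has_derivative D' \<circ> D) (at (chart_map b p))"
    using diff_chain_at[of ?f D "chart_map b p" ?h D'] F H by (simp add: has_chart_deriv_def)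
  then show ?thesis
    unfolding has_chart_deriv_def
  proof (rule has_derivative_transform_within_open)
    show "open ?O" by (rule open_chart_preimage[OF A c])
    show "chart_map b p \<in> ?O" using p A by (simp add: chart_props)
  qed (use A in \<open>auto simp: chart_props\<close>)
qed

lemma has_chart_deriv_curve:
  assumes b: "b \<in> A" and F: "has_chart_deriv b d F (\<gamma> t) D" and c: "continuous_on UNIV \<gamma>" and t: "\<gamma> t \<in> chart_dom b"
    and v: "((\<lambda>s. chart_map b (\<gamma> s)) has_vector_derivative v) (at t)"
  shows "((\<lambda>s. chart_map d (F (\<gamma> s))) has_vector_derivative D v) (at t)"
proof -
  let ?f = "chart_map d \<circ> F \<circ> chart_inv b"
  have "(?f \<circ> (\<lambda>s. chart_map b (\<gamma> s)) has_vector_derivative D v) (at t)"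
    using vector_derivative_diff_chain_within[OF v, of ?f D] F
    by (auto simp: has_chart_deriv_def intro: has_derivative_at_withinI)
  then show ?thesis
  proof (rule has_vector_derivative_transform_within_open)
    show "open (\<gamma> -` chart_dom b)" by (rule open_vimage[OF chart_props(1)[OF b] c])
  qed (use t b in \<open>auto simp: chart_props\<close>)
qed

lemma product_map_differentiable:
  assumes "b \<in> A" "c \<in> A" "d \<in> A" "p \<in> chart_dom b" "q \<in> chart_dom c" "p \<otimes> q \<in> chart_dom d"
  shows "(\<lambda>(x, y). chart_map d (chart_inv b x \<otimes> chart_inv c y)) differentiable (at (chart_map b p, chart_map c q))"
proof -
  have "Ck_on (Suc 0) (\<lambda>(x, y). chart_map d (chart_inv b x \<otimes> chart_inv c y))
        {(x, y). x \<in> chart_map b ` chart_dom b \<and> y \<in> chart_map c ` chart_dom c \<and>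
                 chart_inv b x \<otimes> chart_inv c y \<in> chart_dom d}"
    using smooth_mult[OF assms(1-3)] unfolding smooth_on_def by blast
  then show ?thesis using assms by (auto simp: chart_props)
qed

text \<open>Smoothness is assumed of the product map in charts; freezing the first factor at the
  coordinates of \<open>p\<close> in a chart \<open>a\<close> around it gives the
  translation.\<close>

lemma left_mult_has_chart_deriv:
  assumes A: "b \<in> A" "d \<in> A" and q: "q \<in> chart_dom b" "p \<otimes> q \<in> chart_dom d"
  shows "\<exists>D. has_chart_deriv b d (\<lambda>h. p \<otimes> h) q D"
proof -
  obtain a where a: "a \<in> A" "p \<in> chart_dom a" by (rule chart_exists)
  let ?m = "\<lambda>(x, y). chart_map d (chart_inv a x \<otimes> chart_inv b y)"
  let ?i = "\<lambda>y. (chart_map a p, y)"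
  have "?m differentiable (at (?i (chart_map b q)))"
    using product_map_differentiable a A q by simp
  moreover have "?i differentiable (at (chart_map b q))" by (intro derivative_intros)
  ultimately have "(?m \<circ> ?i) differentiable (at (chart_map b q))"
    by (intro differentiable_chain_at)
  then show ?thesis
    using a by (auto simp: has_chart_deriv_def differentiable_def o_def chart_props)
qed

lemma right_mult_has_chart_deriv:
  assumes A: "b \<in> A" "d \<in> A" and q: "q \<in> chart_dom b" "q \<otimes> p \<in> chart_dom d"
  shows "\<exists>D. has_chart_deriv b d (\<lambda>h. h \<otimes> p) q D"
proof -
  obtain a where a: "a \<in> A" "p \<in> chart_dom a" by (rule chart_exists)
  let ?m = "\<lambda>(x, y). chart_map d (chart_inv b x \<otimes> chart_inv a y)"
  let ?i = "\<lambda>y. (y, chart_map a p)"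
  have "?m differentiable (at (?i (chart_map b q)))"
    using product_map_differentiable a A q by simp
  moreover have "?i differentiable (at (chart_map b q))" by (intro derivative_intros)
  ultimately have "(?m \<circ> ?i) differentiable (at (chart_map b q))"
    by (intro differentiable_chain_at)
  then show ?thesis
    using a by (auto simp: has_chart_deriv_def differentiable_def o_def chart_props)
qed

lemma has_chart_deriv_id:
  assumes "b \<in> A" "p \<in> chart_dom b"
  shows "has_chart_deriv b b (\<lambda>x. x) p (\<lambda>v. v)"
  unfolding has_chart_deriv_def
  by (rule has_derivative_transform_within_open[OF has_derivative_ident, of "chart_map b ` chart_dom b"])
     (use assms in \<open>auto simp: chart_props\<close>)

lemma has_chart_deriv_unique:
  "has_chart_deriv b d F p D \<Longrightarrow> has_chart_deriv b d F p D' \<Longrightarrow> D = D'"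
  by (metis has_chart_deriv_imp_eq)

end

section \<open>The Lie algebra through a fixed chart around the identity\<close>

locale lie_group_chart = lie_group G A
  for G :: "'g::{t2_space, second_countable_topology} monoid" (structure)
    and A :: "('g, 'e::euclidean_space) chart set" +
  fixes c :: "('g, 'e) chart"
  assumes c: "c \<in> A" and one_dom: "\<one> \<in> chart_dom c"
begin

text \<open>Velocities are left-translated back to the identity, so that a single chart suffices.\<close>

definition has_velocity :: "(real \<Rightarrow> 'g) \<Rightarrow> 'e \<Rightarrow> real \<Rightarrow> bool" where
  "has_velocity \<gamma> v t \<longleftrightarrow> ((\<lambda>s. chart_map c (inv (\<gamma> t) \<otimes> \<gamma> s)) has_vector_derivative v) (at t)"

lemma left_inv_field_deriv:
  assumes "d \<in> A" "p \<in> chart_dom d"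
  shows "has_chart_deriv c d (\<lambda>h. p \<otimes> h) \<one> (\<lambda>v. left_inv_field G c v d p)"
proof -
  obtain D where D: "has_chart_deriv c d (\<lambda>h. p \<otimes> h) \<one> D"
    using left_mult_has_chart_deriv[OF c assms(1) one_dom, of p] assms by auto
  then show ?thesis
    unfolding left_inv_field_def has_chart_deriv_imp_eq[OF D] by simp
qed

lemma has_velocity_imp_chart_derivative:
  assumes cont: "continuous_on UNIV \<gamma>" and v: "has_velocity \<gamma> v t" and d: "d \<in> A" "\<gamma> t \<in> chart_dom d"
  shows "((\<lambda>s. chart_map d (\<gamma> s)) has_vector_derivative left_inv_field G c v d (\<gamma> t)) (at t)"
proof -
  have "continuous_on UNIV (\<lambda>s. inv (\<gamma> t) \<otimes> \<gamma> s)" by (intro continuous_intros cont)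
  from has_chart_deriv_curve[OF c _ this, of d "\<lambda>h. \<gamma> t \<otimes> h" t]
  show ?thesis using left_inv_field_deriv[OF d] v one_dom by (simp add: has_velocity_def)
qed

text \<open>The differential of translation by \<open>\<gamma> t\<close> has a left inverse, the
  differential of translation by \<open>inv (\<gamma> t)\<close>; it recovers \<open>v\<close> from
  the value of the left-invariant field.\<close>

lemma chart_derivative_imp_has_velocity:
  assumes cont: "continuous_on UNIV \<gamma>" and d: "d \<in> A" "\<gamma> t \<in> chart_dom d"
    and v: "((\<lambda>s. chart_map d (\<gamma> s)) has_vector_derivative left_inv_field G c v d (\<gamma> t)) (at t)"
  shows "has_velocity \<gamma> v t"
proof -
  let ?D = "\<lambda>v. left_inv_field G c v d (\<gamma> t)"
  have D: "has_chart_deriv c d (\<lambda>h. \<gamma> t \<otimes> h) \<one> ?D" by (rule left_inv_field_deriv[OF d])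
  obtain D' where D': "has_chart_deriv d c (\<lambda>h. inv (\<gamma> t) \<otimes> h) (\<gamma> t) D'"
    using left_mult_has_chart_deriv[OF d(1) c d(2), of "inv (\<gamma> t)"] one_dom by auto
  have "has_chart_deriv c c ((\<lambda>h. inv (\<gamma> t) \<otimes> h) \<circ> (\<lambda>h. \<gamma> t \<otimes> h)) \<one> (D' \<circ> ?D)"
    by (rule has_chart_deriv_comp[OF c d(1) D])
       (use D' one_dom d in \<open>auto intro!: continuous_intros\<close>)
  moreover have "(\<lambda>h. inv (\<gamma> t) \<otimes> h) \<circ> (\<lambda>h. \<gamma> t \<otimes> h) = (\<lambda>x. x)" by (simp add: fun_eq_iff)
  ultimately have "D' \<circ> ?D = (\<lambda>v. v)"
    using has_chart_deriv_unique has_chart_deriv_id[OF c one_dom] by metis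
  then have "D' (?D v) = v" by (metis comp_apply)
  then show ?thesis
    using has_chart_deriv_curve[OF d(1) D' cont d(2) v] by (simp add: has_velocity_def)
qed

lemma is_exp_curve_iff:
  "is_exp_curve G A c v \<gamma> \<longleftrightarrow> \<gamma> 0 = \<one> \<and> continuous_on UNIV \<gamma> \<and> (\<forall>t. has_velocity \<gamma> v t)"
proof -
  have "has_velocity \<gamma> v t"
    if "continuous_on UNIV \<gamma>" and *: "\<And>d. d \<in> A \<Longrightarrow> \<gamma> t \<in> chart_dom d \<Longrightarrow>
        ((chart_map d \<circ> \<gamma>) has_vector_derivative left_inv_field G c v d (\<gamma> t)) (at t)" for t
  proof -
    obtain d where "d \<in> A" "\<gamma> t \<in> chart_dom d" by (rule chart_exists)
    with chart_derivative_imp_has_velocity that show ?thesis by (simp add: o_def)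
  qed
  then show ?thesis
    unfolding is_exp_curve_def using has_velocity_imp_chart_derivative unfolding o_def by blast
qed

lemma has_velocity_left_mult [simp]: "has_velocity (\<lambda>s. h \<otimes> \<gamma> s) v t \<longleftrightarrow> has_velocity \<gamma> v t"
  by (simp add: has_velocity_def inv_mult_group m_assoc)

lemma has_velocity_affine:
  assumes "has_velocity \<gamma> v (a + r * t)"
  shows "has_velocity (\<lambda>s. \<gamma> (a + r * s)) (r *\<^sub>R v) t"
proof -
  have "((\<lambda>s. a + r * s) has_vector_derivative r) (at t)"
    by (auto intro!: derivative_eq_intros simp flip: has_real_derivative_iff_has_vector_derivative)
  from vector_diff_chain_at[OF this, of "\<lambda>s. chart_map c (inv (\<gamma> (a + r * t)) \<otimes> \<gamma> s)" v] assms
  show ?thesis by (simp add: has_velocity_def o_def)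
qed

lemma has_velocity_cong:
  assumes "has_velocity \<gamma> v t" "open S" "t \<in> S" "\<And>s. s \<in> S \<Longrightarrow> \<gamma> s = \<gamma>' s"
  shows "has_velocity \<gamma>' v t"
  using assms(1) unfolding has_velocity_def
  by (rule has_vector_derivative_transform_within_open) (use assms in auto)

text \<open>Differentials of translations are linear, so velocity 0 means derivative 0 in every
  chart: the curve is locally constant, hence constant on the connected set \<open>S\<close>. A
  general open \<open>S\<close> serves local solutions, whose velocity is known only near 0.\<close>

lemma has_velocity_zero_imp_constant:
  assumes cont: "continuous_on UNIV \<gamma>" and S: "open S" "connected S" "a \<in> S" "b \<in> S"
    and v: "\<And>t. t \<in> S \<Longrightarrow> has_velocity \<gamma> 0 t"
  shows "\<gamma> a = \<gamma> b"
proof (rule connected_local_const[OF S(2-4)], rule ballI)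
  fix t assume t: "t \<in> S"
  obtain d where d: "d \<in> A" "\<gamma> t \<in> chart_dom d" by (rule chart_exists)
  have "open (S \<inter> \<gamma> -` chart_dom d)"
    by (rule open_Int[OF S(1) open_vimage[OF chart_props(1)[OF d(1)] cont]])
  moreover have "t \<in> S \<inter> \<gamma> -` chart_dom d" using t d by simp
  ultimately obtain e where e: "e > 0" "ball t e \<subseteq> S \<inter> \<gamma> -` chart_dom d"
    by (rule openE)
  have z: "left_inv_field G c 0 d p = 0" if "p \<in> chart_dom d" for p
    using has_chart_deriv_linear[OF left_inv_field_deriv[OF d(1) that]] by (rule linear_simps(3))
  have "((\<lambda>s. chart_map d (\<gamma> s)) has_vector_derivative 0) (at s within ball t e)" if "s \<in> ball t e" for s
  proof -
    have s: "s \<in> S" "\<gamma> s \<in> chart_dom d" using that e by auto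
    show ?thesis
      using has_velocity_imp_chart_derivative[OF cont v[OF s(1)] d(1) s(2)] z[OF s(2)]
      by (simp add: has_vector_derivative_at_within)
  qed
  then obtain k where k: "\<And>s. s \<in> ball t e \<Longrightarrow> chart_map d (\<gamma> s) = k"
    using has_vector_derivative_zero_constant[OF convex_ball, of t e "\<lambda>s. chart_map d (\<gamma> s)"] by blast
  have "\<gamma> t = \<gamma> s" if s: "s \<in> ball t e" for s
  proof -
    have "t \<in> ball t e" using e by simp
    then have "chart_map d (\<gamma> t) = chart_map d (\<gamma> s)" using k[OF s] k[of t] by simp
    moreover have "\<gamma> s \<in> chart_dom d" using s e by auto
    ultimately show ?thesis using chart_map_eq_iff[OF d] by simp
  qed
  then show "eventually (\<lambda>s. \<gamma> t = \<gamma> s) (at t within S)"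
    unfolding eventually_at using e(1) by (intro exI[of _ e]) (simp add: dist_commute)
qed

text \<open>The product \<open>p \<otimes> h\<close> may leave the domain of \<open>c\<close>, so
  conjugation is factored into two translations through a chart \<open>b\<close> around
  \<open>p\<close>.\<close>

lemma conjugation_has_chart_deriv:
  "has_chart_deriv c c (\<lambda>h. p \<otimes> h \<otimes> inv p) \<one> (Ad G c p)"
proof -
  obtain b where b: "b \<in> A" "p \<in> chart_dom b" by (rule chart_exists)
  obtain D where D: "has_chart_deriv c b (\<lambda>h. p \<otimes> h) \<one> D"
    using left_mult_has_chart_deriv[OF c b(1) one_dom, of p] b by auto
  obtain D' where D': "has_chart_deriv b c (\<lambda>h. h \<otimes> inv p) p D'"
    using right_mult_has_chart_deriv[OF b(1) c b(2), of "inv p"] one_dom by auto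
  have "has_chart_deriv c c ((\<lambda>h. h \<otimes> inv p) \<circ> (\<lambda>h. p \<otimes> h)) \<one> (D' \<circ> D)"
    by (rule has_chart_deriv_comp[OF c b(1) D]) (use D' one_dom b in \<open>auto intro!: continuous_intros\<close>)
  then show ?thesis unfolding Ad_def using has_chart_deriv_imp_eq by (auto simp: o_def)
qed

lemma Ad_linear: "bounded_linear (Ad G c p)"
  using conjugation_has_chart_deriv by (rule has_chart_deriv_linear)

lemma Ad_mult: "Ad G c (p \<otimes> q) v = Ad G c p (Ad G c q v)"
proof -
  have "has_chart_deriv c c ((\<lambda>h. p \<otimes> h \<otimes> inv p) \<circ> (\<lambda>h. q \<otimes> h \<otimes> inv q)) \<one> (Ad G c p \<circ> Ad G c q)"
    by (rule has_chart_deriv_comp[OF c c conjugation_has_chart_deriv])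
       (use one_dom conjugation_has_chart_deriv in \<open>auto intro!: continuous_intros\<close>)
  moreover have "(\<lambda>h. p \<otimes> h \<otimes> inv p) \<circ> (\<lambda>h. q \<otimes> h \<otimes> inv q) = (\<lambda>h. (p \<otimes> q) \<otimes> h \<otimes> inv (p \<otimes> q))"
    by (simp add: fun_eq_iff inv_mult_group m_assoc)
  ultimately have "Ad G c p \<circ> Ad G c q = Ad G c (p \<otimes> q)"
    using conjugation_has_chart_deriv has_chart_deriv_unique by metis
  then show ?thesis by (simp add: fun_eq_iff)
qed

lemma Ad_one: "Ad G c \<one> v = v"
  using has_chart_deriv_unique[OF conjugation_has_chart_deriv[of \<one>]] has_chart_deriv_id[OF c one_dom]
  by auto

lemma has_velocity_conj:
  assumes "continuous_on UNIV \<gamma>" "has_velocity \<gamma> v t"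
  shows "has_velocity (\<lambda>s. p \<otimes> \<gamma> s \<otimes> inv p) (Ad G c p v) t"
proof -
  have "((\<lambda>s. chart_map c (p \<otimes> (inv (\<gamma> t) \<otimes> \<gamma> s) \<otimes> inv p)) has_vector_derivative Ad G c p v) (at t)"
    by (rule has_chart_deriv_curve[OF c]) 
       (use assms conjugation_has_chart_deriv one_dom in \<open>auto intro!: continuous_intros simp: has_velocity_def\<close>)
  then show ?thesis by (simp add: has_velocity_def inv_mult_group m_assoc)
qed

text \<open>Multiplication in the chart \<open>c\<close>. Its first-slot and second-slot derivatives
  are the differentials of right and left translations, and its mixed second derivatives at
  \<open>(x0, x0)\<close> carry the bracket.\<close>

definition prod_map :: "'e \<times> 'e \<Rightarrow> 'e" where
  "prod_map = (\<lambda>(x, y). chart_map c (chart_inv c x \<otimes> chart_inv c y))"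

definition prod_dom :: "('e \<times> 'e) set" where
  "prod_dom = {(x, y). x \<in> chart_map c ` chart_dom c \<and> y \<in> chart_map c ` chart_dom c \<and>
                 chart_inv c x \<otimes> chart_inv c y \<in> chart_dom c}"

abbreviation x0 :: 'e where "x0 \<equiv> chart_map c \<one>"

lemma Ck_on_prod_map: "Ck_on k prod_map prod_dom"
  using smooth_mult[OF c c c] unfolding smooth_on_def prod_map_def prod_dom_def by blast

lemma open_prod_dom: "open prod_dom"
proof -
  let ?U = "chart_map c ` chart_dom c"
  have *: "continuous_on (?U \<times> ?U) (\<lambda>z. chart_inv c (fst z) \<otimes> chart_inv c (snd z))"
    by (intro continuous_intros continuous_on_compose2[OF chart_props(4)[OF c]]) auto
  have "open ((\<lambda>z. chart_inv c (fst z) \<otimes> chart_inv c (snd z)) -` chart_dom c \<inter> ?U \<times> ?U)"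
    using * chart_props(1)[OF c] continuous_on_open_vimage[OF open_Times] chart_props(2)[OF c] by blast
  also have "(\<lambda>z. chart_inv c (fst z) \<otimes> chart_inv c (snd z)) -` chart_dom c \<inter> ?U \<times> ?U = prod_dom"
    by (auto simp: prod_dom_def)
  finally show ?thesis .
qed

lemma one_mem_prod_dom:
  assumes "p \<in> chart_dom c"
  shows "(chart_map c p, x0) \<in> prod_dom" "(x0, chart_map c p) \<in> prod_dom"
  using assms one_dom c by (auto simp: prod_dom_def chart_props)

lemma prod_map_has_derivative:
  "z \<in> prod_dom \<Longrightarrow> (prod_map has_derivative frechet_derivative prod_map (at z)) (at z)"
  using Ck_on_prod_map[of "Suc 0"] frechet_derivative_works by auto

lemma prod_map_deriv_left:
  assumes p: "p \<in> chart_dom c"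
  shows "has_chart_deriv c c (\<lambda>h. h \<otimes> p) \<one> (\<lambda>u. frechet_derivative prod_map (at (x0, chart_map c p)) (u, 0))"
proof -
  have 1: "((\<lambda>x. (x, chart_map c p)) has_derivative (\<lambda>u. (u, 0))) (at x0)"
    by (auto intro!: derivative_eq_intros)
  have "(prod_map \<circ> (\<lambda>x. (x, chart_map c p)) has_derivative
      frechet_derivative prod_map (at (x0, chart_map c p)) \<circ> (\<lambda>u. (u, 0))) (at x0)"
    by (rule diff_chain_at[OF 1 prod_map_has_derivative]) (rule one_mem_prod_dom[OF p])
  then show ?thesis
    using p c by (simp add: has_chart_deriv_def o_def prod_map_def chart_props)
qed

lemma prod_map_deriv_right:
  assumes p: "p \<in> chart_dom c"
  shows "has_chart_deriv c c (\<lambda>h. p \<otimes> h) \<one> (\<lambda>u. frechet_derivative prod_map (at (chart_map c p, x0)) (0, u))"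
proof -
  have 1: "((\<lambda>x. (chart_map c p, x)) has_derivative (\<lambda>u. (0, u))) (at x0)"
    by (auto intro!: derivative_eq_intros)
  have "(prod_map \<circ> (\<lambda>x. (chart_map c p, x)) has_derivative
      frechet_derivative prod_map (at (chart_map c p, x0)) \<circ> (\<lambda>u. (0, u))) (at x0)"
    by (rule diff_chain_at[OF 1 prod_map_has_derivative]) (rule one_mem_prod_dom[OF p])
  then show ?thesis
    using p c by (simp add: has_chart_deriv_def o_def prod_map_def chart_props)
qed

lemma prod_map_deriv_one:
  "frechet_derivative prod_map (at (x0, x0)) (u, 0) = u"
  "frechet_derivative prod_map (at (x0, x0)) (0, u) = u"
proof -
  note id = has_chart_deriv_id[OF c one_dom]
  have "(\<lambda>u. frechet_derivative prod_map (at (x0, x0)) (u, 0)) = (\<lambda>u. u)"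
    using prod_map_deriv_left[OF one_dom] id has_chart_deriv_unique by simp
  then show "frechet_derivative prod_map (at (x0, x0)) (u, 0) = u" by meson
  have "(\<lambda>u. frechet_derivative prod_map (at (x0, x0)) (0, u)) = (\<lambda>u. u)"
    using prod_map_deriv_right[OF one_dom] id has_chart_deriv_unique by simp
  then show "frechet_derivative prod_map (at (x0, x0)) (0, u) = u" by meson
qed

text \<open>The differential of multiplication at the pair of identities is addition: both partial
  derivatives are the identity, and linearity combines them.\<close>

lemma chart_mult_has_vector_derivative:
  assumes a: "continuous_on UNIV a" "a t = \<one>" "((\<lambda>s. chart_map c (a s)) has_vector_derivative v) (at t)"
    and b: "continuous_on UNIV b" "b t = \<one>" "((\<lambda>s. chart_map c (b s)) has_vector_derivative w) (at t)"
  shows "((\<lambda>s. chart_map c (a s \<otimes> b s)) has_vector_derivative v + w) (at t)"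
proof -
  let ?D = "frechet_derivative prod_map (at (x0, x0))"
  have D: "(prod_map has_derivative ?D) (at (x0, x0))"
    by (rule prod_map_has_derivative) (rule one_mem_prod_dom[OF one_dom])
  have "?D (v, w) = ?D ((v, 0) + (0, w))" by simp
  also have "\<dots> = v + w"
    using linear_add[OF bounded_linear.linear[OF has_derivative_bounded_linear[OF D]], of "(v, 0)" "(0, w)"] prod_map_deriv_one
    by simp
  finally have "?D (v, w) = v + w" .
  moreover have "((\<lambda>s. (chart_map c (a s), chart_map c (b s))) has_vector_derivative (v, w)) (at t)"
    using a b by (intro has_vector_derivative_Pair)
  ultimately have "(prod_map \<circ> (\<lambda>s. (chart_map c (a s), chart_map c (b s))) has_vector_derivative v + w) (at t)"
    using vector_derivative_diff_chain_within[of "\<lambda>s. (chart_map c (a s), chart_map c (b s))" "(v, w)" t UNIV prod_map ?D] D a b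
    by (auto intro: has_derivative_at_withinI)
  then show ?thesis
  proof (rule has_vector_derivative_transform_within_open)
    show "open (a -` chart_dom c \<inter> b -` chart_dom c)"
      by (intro open_Int open_vimage chart_props c a b)
  qed (use a b one_dom c in \<open>auto simp: prod_map_def chart_props\<close>)
qed

lemma inverse_has_chart_deriv: "\<exists>D. has_chart_deriv c c (\<lambda>h. inv h) \<one> D"
proof -
  have "Ck_on (Suc 0) (\<lambda>x. chart_map c (inv (chart_inv c x)))
      {x. x \<in> chart_map c ` chart_dom c \<and> inv (chart_inv c x) \<in> chart_dom c}"
    using smooth_inv[OF c c] unfolding smooth_on_def by blast
  then have "(\<lambda>x. chart_map c (inv (chart_inv c x))) differentiable (at x0)"
    using one_dom c by (auto simp: chart_props)
  then show ?thesis by (auto simp: has_chart_deriv_def differentiable_def o_def)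
qed

text \<open>Smoothness of inversion gives some derivative \<open>D v\<close>; differentiating
  \<open>a s \<otimes> inv (a s) = \<one>\<close> then identifies it.\<close>

lemma chart_inverse_has_vector_derivative:
  assumes a: "continuous_on UNIV a" "a t = \<one>" "((\<lambda>s. chart_map c (a s)) has_vector_derivative v) (at t)"
  shows "((\<lambda>s. chart_map c (inv (a s))) has_vector_derivative - v) (at t)"
proof -
  obtain D where D: "has_chart_deriv c c (\<lambda>h. inv h) \<one> D" using inverse_has_chart_deriv by blast
  have i: "((\<lambda>s. chart_map c (inv (a s))) has_vector_derivative D v) (at t)"
    by (rule has_chart_deriv_curve[OF c]) (use a D one_dom in auto)
  have "((\<lambda>s. chart_map c (a s \<otimes> inv (a s))) has_vector_derivative v + D v) (at t)"
    by (rule chart_mult_has_vector_derivative) (use a i in \<open>auto intro!: continuous_intros\<close>)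
  then have "v + D v = 0"
    using vector_derivative_unique_at[OF _ has_vector_derivative_const] by (simp add: r_inv)
  then have "D v = - v" by (simp add: add_eq_0_iff)
  with i show ?thesis by simp
qed

text \<open>The product, translated back, is the product of
  \<open>inv (\<gamma> t) \<otimes> \<gamma> s\<close>, conjugated by \<open>inv (\<eta> t)\<close>,
  and of \<open>inv (\<eta> t) \<otimes> \<eta> s\<close>. Both factors pass through the identity at
  \<open>s = t\<close>, so their derivatives add.\<close>

lemma has_velocity_mult:
  assumes "continuous_on UNIV \<gamma>" "has_velocity \<gamma> v t" "continuous_on UNIV \<eta>" "has_velocity \<eta> w t"
  shows "has_velocity (\<lambda>s. \<gamma> s \<otimes> \<eta> s) (Ad G c (inv (\<eta> t)) v + w) t"
proof -
  have "has_velocity (\<lambda>s. inv (\<eta> t) \<otimes> \<gamma> s \<otimes> inv (inv (\<eta> t))) (Ad G c (inv (\<eta> t)) v) t"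
    by (rule has_velocity_conj[OF assms(1,2)])
  then have "((\<lambda>s. chart_map c ((inv (\<eta> t) \<otimes> inv (\<gamma> t) \<otimes> \<gamma> s \<otimes> \<eta> t) \<otimes> (inv (\<eta> t) \<otimes> \<eta> s)))
      has_vector_derivative Ad G c (inv (\<eta> t)) v + w) (at t)"
    using assms
    by (intro chart_mult_has_vector_derivative)
       (auto simp: has_velocity_def inv_mult_group m_assoc intro!: continuous_intros)
  then show ?thesis by (simp add: has_velocity_def inv_mult_group m_assoc)
qed

lemma has_velocity_unique_curve:
  assumes \<gamma>: "continuous_on UNIV \<gamma>" "\<And>t. t \<in> S \<Longrightarrow> has_velocity \<gamma> v t"
    and \<eta>: "continuous_on UNIV \<eta>" "\<And>t. t \<in> S \<Longrightarrow> has_velocity \<eta> v t"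
    and S: "open S" "connected S" "a \<in> S" "b \<in> S" and eq: "\<gamma> a = \<eta> a"
  shows "\<gamma> b = \<eta> b"
proof -
  have vel: "has_velocity (\<lambda>s. \<gamma> s \<otimes> inv (\<eta> s)) 0 t" if t: "t \<in> S" for t
  proof -
    have "((\<lambda>s. chart_map c ((inv (\<gamma> t) \<otimes> \<gamma> s) \<otimes> inv (inv (\<eta> t) \<otimes> \<eta> s))) has_vector_derivative v + - v) (at t)"
      using \<gamma> \<eta> t
      by (intro chart_mult_has_vector_derivative chart_inverse_has_vector_derivative)
         (auto simp: has_velocity_def inv_mult_group m_assoc intro!: continuous_intros)
    then have 1: "has_velocity (\<lambda>s. inv (\<gamma> t) \<otimes> \<gamma> s \<otimes> inv (inv (\<eta> t) \<otimes> \<eta> s)) 0 t"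
      by (simp add: has_velocity_def)
    \<comment> \<open>Conjugating by \<open>\<eta> t\<close> turns the curve into a constant times
      \<open>\<gamma> s \<otimes> inv (\<eta> s)\<close>; \<open>Ad\<close> keeps the velocity 0 and
      the constant left factor does not affect it.\<close>
    have "has_velocity (\<lambda>s. \<eta> t \<otimes> (inv (\<gamma> t) \<otimes> \<gamma> s \<otimes> inv (inv (\<eta> t) \<otimes> \<eta> s)) \<otimes> inv (\<eta> t)) (Ad G c (\<eta> t) 0) t"
      by (rule has_velocity_conj) (use 1 \<gamma> \<eta> in \<open>auto intro!: continuous_intros\<close>)
    then have "has_velocity (\<lambda>s. (\<eta> t \<otimes> inv (\<gamma> t)) \<otimes> (\<gamma> s \<otimes> inv (\<eta> s))) 0 t"
      using linear_simps(3)[OF Ad_linear] by (simp add: inv_mult_group m_assoc)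
    then show ?thesis by simp
  qed
  have "continuous_on UNIV (\<lambda>s. \<gamma> s \<otimes> inv (\<eta> s))" by (intro continuous_intros \<gamma> \<eta>)
  then have "\<gamma> a \<otimes> inv (\<eta> a) = \<gamma> b \<otimes> inv (\<eta> b)"
    by (rule has_velocity_zero_imp_constant[OF _ S vel])
  then have "\<gamma> b \<otimes> inv (\<eta> b) = \<one>" using eq by (simp add: r_inv)
  then show ?thesis using inv_equality[of "\<gamma> b" "inv (\<eta> b)"] by simp
qed

subsection \<open>The exponential map\<close>

abbreviation chart_field :: "'e \<Rightarrow> 'e \<Rightarrow> 'e" where
  "chart_field v x \<equiv> left_inv_field G c v c (chart_inv c x)"

lemma left_inv_field_prod_map:
  assumes "p \<in> chart_dom c"
  shows "left_inv_field G c v c p = frechet_derivative prod_map (at (chart_map c p, x0)) (0, v)"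
  using has_chart_deriv_unique[OF left_inv_field_deriv[OF c assms] prod_map_deriv_right[OF assms]]
  by (rule fun_cong)

lemma prod_map_partial_has_derivative:
  assumes "z \<in> prod_dom"
  shows "((\<lambda>z. frechet_derivative prod_map (at z) u) has_derivative
    frechet_derivative (\<lambda>z. frechet_derivative prod_map (at z) u) (at z)) (at z)"
  using Ck_on_2D(2)[OF Ck_on_prod_map assms] by (simp add: frechet_derivative_works[symmetric])

text \<open>The field at \<open>x\<close> is the second-slot derivative of \<open>prod_map\<close>
  at \<open>(x, x0)\<close>. Moving \<open>x\<close> varies the first slot, so a mixed second
  derivative appears; from it come both the regularity needed for the local solution and the formula
  for the bracket.\<close>

lemma chart_field_has_derivative:
  assumes x: "x \<in> chart_map c ` chart_dom c"
  shows "(chart_field v has_derivative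
    (\<lambda>w. frechet_derivative (\<lambda>z. frechet_derivative prod_map (at z) (0, v)) (at (x, x0)) (w, 0))) (at x)"
proof -
  let ?F = "\<lambda>z. frechet_derivative prod_map (at z) (0, v)"
  have z: "(y, x0) \<in> prod_dom" if "y \<in> chart_map c ` chart_dom c" for y
    using that one_mem_prod_dom by blast
  have 1: "((\<lambda>y. (y, x0)) has_derivative (\<lambda>w. (w, 0))) (at x)"
    by (auto intro!: derivative_eq_intros)
  have "(?F \<circ> (\<lambda>y. (y, x0)) has_derivative frechet_derivative ?F (at (x, x0)) \<circ> (\<lambda>w. (w, 0))) (at x)"
    by (rule diff_chain_at[OF 1 prod_map_partial_has_derivative[OF z[OF x]]])
  then have "(?F \<circ> (\<lambda>y. (y, x0)) has_derivative (\<lambda>w. frechet_derivative ?F (at (x, x0)) (w, 0))) (at x)"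
    by (simp add: o_def)
  then show ?thesis
    by (rule has_derivative_transform_within_open[OF _ chart_props(2)[OF c] x])
       (auto simp: left_inv_field_prod_map chart_props c)
qed

lemma Ck_on_chart_field: "Ck_on (Suc 0) (chart_field v) (chart_map c ` chart_dom c)"
proof -
  let ?U = "chart_map c ` chart_dom c"
  let ?F = "\<lambda>z. frechet_derivative prod_map (at z) (0, v)"
  have "continuous_on ?U (\<lambda>x. frechet_derivative (chart_field v) (at x) w)" for w
  proof -
    have *: "continuous_on prod_dom (\<lambda>z. frechet_derivative ?F (at z) (w, 0))"
      by (rule Ck_on_2D(4)[OF Ck_on_prod_map])
    have "continuous_on ?U (\<lambda>x. frechet_derivative ?F (at (x, x0)) (w, 0))"
      by (rule continuous_on_compose2[OF *, of _ "\<lambda>x. (x, x0)"])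
         (use one_mem_prod_dom in \<open>auto intro!: continuous_intros\<close>)
    moreover have "frechet_derivative (chart_field v) (at x) w = frechet_derivative ?F (at (x, x0)) (w, 0)"
      if "x \<in> ?U" for x
      using frechet_derivative_at[OF chart_field_has_derivative[OF that]] by (rule fun_cong[symmetric])
    ultimately show ?thesis by (simp cong: continuous_on_cong)
  qed
  moreover have "chart_field v differentiable (at x)" if "x \<in> ?U" for x
    using chart_field_has_derivative[OF that] by (rule differentiableI)
  ultimately show ?thesis by simp
qed

lemma local_exp_curve:
  "\<exists>\<epsilon>>0. \<exists>\<gamma>. \<gamma> 0 = \<one> \<and> continuous_on UNIV \<gamma> \<and> (\<forall>t\<in>{-\<epsilon><..<\<epsilon>}. has_velocity \<gamma> v t)"
proof -
  let ?U = "chart_map c ` chart_dom c"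
  have "x0 \<in> ?U" using one_dom by simp
  then obtain r L where r: "r > 0" "cball x0 r \<subseteq> ?U" and "L-lipschitz_on (cball x0 r) (chart_field v)"
    using C1_imp_lipschitz_on_cball[OF Ck_on_chart_field chart_props(2)[OF c]] by blast
  from picard_local_solution[OF r(1) this(3)] obtain \<epsilon> x where \<epsilon>: "\<epsilon> > 0" and x: "x 0 = x0" "continuous_on UNIV x"
    "\<And>t. x t \<in> cball x0 r" "\<And>t. t \<in> {-\<epsilon><..<\<epsilon>} \<Longrightarrow> (x has_vector_derivative chart_field v (x t)) (at t)"
    by blast
  define \<gamma> where "\<gamma> t = chart_inv c (x t)" for t
  have xU: "x t \<in> ?U" for t using x(3) r(2) by blast
  have \<gamma>: "\<gamma> t \<in> chart_dom c" "chart_map c (\<gamma> t) = x t" for t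
    using xU c by (simp_all add: \<gamma>_def chart_props)
  have cont: "continuous_on UNIV \<gamma>"
    unfolding \<gamma>_def by (rule continuous_on_compose2[OF chart_props(4)[OF c] x(2)]) (use xU in auto)
  moreover have "\<gamma> 0 = \<one>" using x(1) one_dom c by (simp add: \<gamma>_def chart_props)
  moreover have "has_velocity \<gamma> v t" if "t \<in> {-\<epsilon><..<\<epsilon>}" for t
    by (rule chart_derivative_imp_has_velocity[OF cont c]) (use \<gamma> x(4)[OF that] in \<open>simp_all add: \<gamma>_def\<close>)
  ultimately show ?thesis using \<epsilon> by blast
qed

text \<open>A local solution \<open>\<eta>\<close> is a local homomorphism by uniqueness. Hence it
  extends to the whole line: split off the integer multiple of \<open>h\<close> in the time and use
  the corresponding power of \<open>\<eta> h\<close>.\<close>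

lemma exp_curve_exists: "\<exists>\<gamma>. is_exp_curve G A c v \<gamma>"
proof -
  obtain \<epsilon> \<eta> where \<epsilon>: "\<epsilon> > 0" and \<eta>: "\<eta> 0 = \<one>" "continuous_on UNIV \<eta>"
    "\<And>t. t \<in> {-\<epsilon><..<\<epsilon>} \<Longrightarrow> has_velocity \<eta> v t"
    using local_exp_curve by blast
  \<comment> \<open>Half of \<open>\<epsilon>\<close>, so that \<open>h + u\<close> stays in the
    domain of the local solution for all \<open>u\<close> between \<open>-h\<close> and
    \<open>h\<close>.\<close>
  define h where "h = \<epsilon> / 2"
  have h: "h > 0" using \<epsilon> by (simp add: h_def)
  have hom: "\<eta> (h + u) = \<eta> h \<otimes> \<eta> u" if "u \<in> {-h<..<h}" for u
  proof (rule has_velocity_unique_curve[where S = "{-h<..<h}" and a = 0])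
    show "continuous_on UNIV (\<lambda>u. \<eta> (h + u))"
      by (rule continuous_on_compose2[OF \<eta>(2)]) (auto intro!: continuous_intros)
    show "continuous_on UNIV (\<lambda>u. \<eta> h \<otimes> \<eta> u)" by (intro continuous_intros \<eta>)
    show "has_velocity (\<lambda>u. \<eta> (h + u)) v t" if "t \<in> {-h<..<h}" for t
      using has_velocity_affine[of \<eta> v h 1 t] \<eta>(3)[of "h + t"] that by (auto simp: h_def)
    show "has_velocity (\<lambda>u. \<eta> h \<otimes> \<eta> u) v t" if "t \<in> {-h<..<h}" for t
      using \<eta>(3) that by (auto simp: h_def)
  qed (use h \<eta> that in auto)
  define \<gamma> where "\<gamma> t = \<eta> h [^] \<lfloor>t / h\<rfloor> \<otimes> \<eta> (t - h * \<lfloor>t / h\<rfloor>)" for t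
  \<comment> \<open>These intervals overlap: each breakpoint \<open>h * k\<close> is the midpoint of
    \<open>S k\<close>, where a single formula holds on both sides. Continuity and velocity of
    \<open>\<gamma>\<close> can thus be checked on open sets.\<close>
  define S where "S k = {h * (of_int k - 1)<..<h * (of_int k + 1)}" for k :: int
  have \<gamma>: "\<gamma> t = \<eta> h [^] k \<otimes> \<eta> (t - h * of_int k)" if t: "t \<in> S k" for t k
  proof (cases "h * k \<le> t")
    case True
    then have "\<lfloor>t / h\<rfloor> = k" using t h by (intro floor_unique) (auto simp: S_def field_simps)
    then show ?thesis by (simp add: \<gamma>_def)
  next
    case False
    have fl: "\<lfloor>t / h\<rfloor> = k - 1"
      using False t h by (intro floor_unique) (auto simp: S_def field_simps)
    have "\<eta> (t - h * of_int (k - 1)) = \<eta> (h + (t - h * of_int k))" by (simp add: algebra_simps)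
    also have "\<dots> = \<eta> h \<otimes> \<eta> (t - h * of_int k)"
      using False t h by (intro hom) (auto simp: S_def algebra_simps)
    finally have "\<gamma> t = (\<eta> h [^] (k - 1) \<otimes> \<eta> h) \<otimes> \<eta> (t - h * of_int k)"
      unfolding \<gamma>_def fl by (simp add: m_assoc)
    also have "\<eta> h [^] (k - 1) \<otimes> \<eta> h = \<eta> h [^] k"
      using int_pow_mult[of "\<eta> h" "k - 1" 1] by (simp add: int_pow_1)
    finally show ?thesis .
  qed
  have S: "open (S k)" for k by (simp add: S_def)
  have in_S: "t \<in> S \<lfloor>t / h\<rfloor>" for t
  proof -
    have "of_int \<lfloor>t / h\<rfloor> * h \<le> t" "t < (of_int \<lfloor>t / h\<rfloor> + 1) * h"
      using h by (rule floor_divide_lower, rule floor_divide_upper)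
    then show ?thesis using h by (auto simp: S_def algebra_simps)
  qed
  have "continuous_on (\<Union>k\<in>UNIV. S k) \<gamma>"
  proof (rule continuous_on_open_UN)
    fix k
    have "continuous_on (S k) (\<lambda>t. \<eta> h [^] k \<otimes> \<eta> (t - h * of_int k))"
      by (intro continuous_intros continuous_on_compose2[OF \<eta>(2)]) auto
    then show "continuous_on (S k) \<gamma>" using \<gamma> by (simp cong: continuous_on_cong)
  qed (simp add: S)
  moreover have "(\<Union>k\<in>UNIV. S k) = UNIV" using in_S by blast
  ultimately have "continuous_on UNIV \<gamma>" by simp
  moreover have "has_velocity \<gamma> v t" for t
  proof (rule has_velocity_cong[OF _ S in_S])
    let ?k = "\<lfloor>t / h\<rfloor>"
    have "t - h * of_int ?k \<in> {-\<epsilon><..<\<epsilon>}"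
      using in_S[of t] h by (auto simp: S_def h_def algebra_simps)
    then have "has_velocity \<eta> v (- h * of_int ?k + 1 * t)" using \<eta>(3) by (simp add: algebra_simps)
    from has_velocity_affine[OF this]
    have "has_velocity (\<lambda>s. \<eta> (s - h * of_int ?k)) v t" by (simp add: algebra_simps)
    then show "has_velocity (\<lambda>s. \<eta> h [^] ?k \<otimes> \<eta> (s - h * of_int ?k)) v t" by simp
    show "\<eta> h [^] ?k \<otimes> \<eta> (s - h * of_int ?k) = \<gamma> s" if "s \<in> S ?k" for s
      using \<gamma>[OF that] by simp
  qed
  moreover have "\<gamma> 0 = \<one>" using \<eta>(1) by (simp add: \<gamma>_def)
  ultimately show ?thesis unfolding is_exp_curve_iff by blast
qed

lemma is_exp_curve_unique:
  assumes "is_exp_curve G A c v \<gamma>" "is_exp_curve G A c v \<eta>"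
  shows "\<gamma> = \<eta>"
proof
  fix t
  show "\<gamma> t = \<eta> t"
    by (rule has_velocity_unique_curve[where S = UNIV and a = 0 and v = v])
       (use assms in \<open>auto simp: is_exp_curve_iff\<close>)
qed

definition exp_curve :: "'e \<Rightarrow> real \<Rightarrow> 'g" where
  "exp_curve v = (THE \<gamma>. is_exp_curve G A c v \<gamma>)"

lemma is_exp_curve_exp_curve: "is_exp_curve G A c v (exp_curve v)"
  unfolding exp_curve_def using exp_curve_exists is_exp_curve_unique by (metis theI)

lemma exp_curve_props:
  "exp_curve v 0 = \<one>" "continuous_on UNIV (exp_curve v)" "has_velocity (exp_curve v) v t"
  using is_exp_curve_exp_curve unfolding is_exp_curve_iff by auto

lemma exp_curveI: "is_exp_curve G A c v \<gamma> \<Longrightarrow> exp_curve v = \<gamma>"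
  using is_exp_curve_exp_curve is_exp_curve_unique by blast

lemma exp_curve_add: "exp_curve v (s + t) = exp_curve v s \<otimes> exp_curve v t"
proof -
  have "is_exp_curve G A c v (\<lambda>t. inv (exp_curve v s) \<otimes> exp_curve v (s + 1 * t))"
    unfolding is_exp_curve_iff
    using has_velocity_affine[OF exp_curve_props(3), of v s 1]
    by (auto intro!: continuous_intros continuous_on_compose2[OF exp_curve_props(2)])
  then have "exp_curve v t = inv (exp_curve v s) \<otimes> exp_curve v (s + t)"
    using exp_curveI by (metis mult_1)
  then show ?thesis by simp
qed

lemma lie_exp_scaleR: "lie_exp G A c (r *\<^sub>R v) = exp_curve v r"
proof -
  have "is_exp_curve G A c (r *\<^sub>R v) (\<lambda>t. exp_curve v (0 + r * t))"
    unfolding is_exp_curve_iff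
    using has_velocity_affine[OF exp_curve_props(3), of v 0 r] exp_curve_props
    by (auto intro!: continuous_intros continuous_on_compose2[OF exp_curve_props(2)])
  then show ?thesis
    using exp_curveI unfolding lie_exp_def exp_curve_def[symmetric] by fastforce
qed

lemma lie_exp_eq: "lie_exp G A c v = exp_curve v 1"
  using lie_exp_scaleR[of 1] by simp

lemma lie_exp_0: "lie_exp G A c 0 = \<one>"
  using lie_exp_scaleR[of 0] exp_curve_props(1) by simp

lemma lie_exp_conj: "p \<otimes> lie_exp G A c v \<otimes> inv p = lie_exp G A c (Ad G c p v)"
proof -
  have "is_exp_curve G A c (Ad G c p v) (\<lambda>t. p \<otimes> exp_curve v t \<otimes> inv p)"
    unfolding is_exp_curve_iff using exp_curve_props
    by (auto intro!: continuous_intros has_velocity_conj)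
  then show ?thesis using exp_curveI by (metis lie_exp_eq)
qed

section \<open>The bracket, the adjoint action and commuting exponentials\<close>

lemma chart_exp_curve_has_vector_derivative:
  "((\<lambda>s. chart_map c (exp_curve v s)) has_vector_derivative v) (at 0)"
  using exp_curve_props[of v] exp_curve_props(3)[of v 0] by (simp add: has_velocity_def)

text \<open>Since \<open>p \<otimes> h = (p \<otimes> h \<otimes> inv p) \<otimes> p\<close>, the
  left-invariant field of \<open>w\<close> agrees at \<open>p\<close> with the right-invariant field
  of \<open>Ad G c p w\<close>. This expresses \<open>Ad\<close> through derivatives of
  \<open>prod_map\<close>.\<close>

lemma left_inv_field_Ad:
  assumes p: "p \<in> chart_dom c"
  shows "left_inv_field G c w c p = frechet_derivative prod_map (at (x0, chart_map c p)) (Ad G c p w, 0)"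
proof -
  have "has_chart_deriv c c ((\<lambda>h. h \<otimes> p) \<circ> (\<lambda>h. p \<otimes> h \<otimes> inv p)) \<one>
      ((\<lambda>u. frechet_derivative prod_map (at (x0, chart_map c p)) (u, 0)) \<circ> Ad G c p)"
    by (rule has_chart_deriv_comp[OF c c conjugation_has_chart_deriv])
       (use prod_map_deriv_left[OF p] one_dom in \<open>auto intro!: continuous_intros\<close>)
  moreover have "(\<lambda>h. h \<otimes> p) \<circ> (\<lambda>h. p \<otimes> h \<otimes> inv p) = (\<lambda>h. p \<otimes> h)"
    by (simp add: fun_eq_iff m_assoc)
  ultimately have "(\<lambda>u. frechet_derivative prod_map (at (x0, chart_map c p)) (u, 0)) \<circ> Ad G c p =
      (\<lambda>v. left_inv_field G c v c p)"
    using has_chart_deriv_unique left_inv_field_deriv[OF c p] by metis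
  from fun_cong[OF this, of w] show ?thesis by simp
qed

lemma lie_bracket_eq:
  "lie_bracket G c v w =
    frechet_derivative (\<lambda>z. frechet_derivative prod_map (at z) (0, w)) (at (x0, x0)) (v, 0) -
    frechet_derivative (\<lambda>z. frechet_derivative prod_map (at z) (0, v)) (at (x0, x0)) (w, 0)"
proof -
  have x0: "x0 \<in> chart_map c ` chart_dom c" using one_dom by simp
  have "chart_field u x0 = u" for u
    using one_dom c by (simp add: left_inv_field_prod_map chart_props prod_map_deriv_one)
  then show ?thesis
    using frechet_derivative_at[OF chart_field_has_derivative[OF x0], symmetric]
    by (simp add: lie_bracket_def Let_def)
qed

text \<open>Differentiability of \<open>K\<close> is part of the claim, so \<open>K\<close> is
  reached indirectly. With \<open>R\<close> the differential of right translation,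
  \<open>left_inv_field_Ad\<close> gives \<open>e s = R (x s) (K s - w)\<close>. The derivative of
  \<open>e\<close> at 0 is the bracket, hence 0; as \<open>R (x s)\<close> is close to the identity,
  \<open>K s - w\<close> is as small as \<open>e s\<close>, namely o(s).\<close>

lemma Ad_exp_curve_has_vector_derivative_0:
  assumes br: "lie_bracket G c v w = 0"
  shows "((\<lambda>s. Ad G c (exp_curve v s) w) has_vector_derivative 0) (at 0)"
proof -
  let ?\<gamma> = "exp_curve v"
  define x where "x s = chart_map c (?\<gamma> s)" for s
  define R where "R y u = frechet_derivative prod_map (at (x0, y)) (u, 0)" for y u
  define K where "K s = Ad G c (?\<gamma> s) w" for s
  define e where "e s = left_inv_field G c w c (?\<gamma> s) - R (x s) w" for s
  \<comment> \<open>An upper bound for the operator norm of \<open>R (x s) - id\<close> that is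
    continuous in \<open>s\<close> at 0.\<close>
  define N where "N s = (\<Sum>b\<in>Basis. norm (R (x s) b - b))" for s
  have \<gamma>0: "?\<gamma> 0 = \<one>" by (rule exp_curve_props)
  have x: "x 0 = x0" "(x has_vector_derivative v) (at 0)"
    using chart_exp_curve_has_vector_derivative[of v] unfolding x_def by (simp_all add: \<gamma>0)
  have z: "(x0, x0) \<in> prod_dom" by (rule one_mem_prod_dom[OF one_dom])
  have xl: "((\<lambda>s. (x s, x0)) has_vector_derivative (v, 0)) (at 0)"
    and xr: "((\<lambda>s. (x0, x s)) has_vector_derivative (0, v)) (at 0)"
    using x by (auto intro!: has_vector_derivative_Pair)
  let ?O = "?\<gamma> -` chart_dom c"
  have O: "open ?O" "0 \<in> ?O"
    using open_vimage[OF chart_props(1)[OF c] exp_curve_props(2)] \<gamma>0 one_dom by auto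
  then have near: "eventually (\<lambda>s. ?\<gamma> s \<in> chart_dom c) (at 0)"
    by (auto simp: eventually_at_topological)
  let ?D = "\<lambda>u z. frechet_derivative prod_map (at z) u"
  have D: "(?D u has_derivative frechet_derivative (?D u) (at (x0, x0))) (at (x0, x0))" for u
    by (rule prod_map_partial_has_derivative[OF z])
  have "((\<lambda>s. ?D (0, w) (x s, x0)) has_vector_derivative frechet_derivative (?D (0, w)) (at (x0, x0)) (v, 0)) (at 0)"
    using vector_derivative_diff_chain_within[OF xl, of "?D (0, w)"] D x(1)
    by (auto simp: o_def intro: has_derivative_at_withinI)
  then have X: "((\<lambda>s. left_inv_field G c w c (?\<gamma> s)) has_vector_derivative
      frechet_derivative (?D (0, w)) (at (x0, x0)) (v, 0)) (at 0)"
    by (rule has_vector_derivative_transform_within_open[OF _ O]) (simp add: left_inv_field_prod_map x_def)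
  have Rd: "((\<lambda>s. R (x s) u) has_vector_derivative frechet_derivative (?D (u, 0)) (at (x0, x0)) (0, v)) (at 0)" for u
    using vector_derivative_diff_chain_within[OF xr, of "?D (u, 0)"] D x(1)
    by (auto simp: o_def R_def intro: has_derivative_at_withinI)
  \<comment> \<open>After this exchange of the order of differentiation, the derivatives of the two
    terms of \<open>e\<close> are exactly the two terms in \<open>lie_bracket_eq\<close>.\<close>
  have "frechet_derivative (?D (w, 0)) (at (x0, x0)) (0, v) = frechet_derivative (?D (0, v)) (at (x0, x0)) (w, 0)"
    by (rule frechet_derivative_commute[OF Ck_on_prod_map open_prod_dom z])
  then have e': "(e has_vector_derivative 0) (at 0)"
    using has_vector_derivative_diff[OF X Rd[of w]] br unfolding e_def lie_bracket_eq by simp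
  have R0: "R x0 u = u" for u by (simp add: R_def prod_map_deriv_one)
  have e0: "e 0 = 0"
    using one_dom by (simp add: e_def x R0 \<gamma>0 left_inv_field_prod_map prod_map_deriv_one)
  have "isCont (\<lambda>s. R (x s) u) 0" for u
    using Rd has_vector_derivative_continuous by blast
  then have "isCont N 0" unfolding N_def by (intro continuous_intros)
  then have "N \<midarrow>0\<rightarrow> N 0" by (simp add: isCont_def)
  moreover have "N 0 = 0" by (simp add: N_def x R0)
  ultimately have smallN: "eventually (\<lambda>s. N s < 1/2) (at 0)"
    by (intro order_tendstoD(2)) auto
  \<comment> \<open>If \<open>R (x s)\<close> differs from the identity by at most 1/2, then
    \<open>norm u \<le> norm (R (x s) u) + norm u / 2\<close>, which is solved for
    \<open>norm u\<close>.\<close>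
  have K_le: "norm (K s - w) \<le> 2 * norm (e s)" if s: "?\<gamma> s \<in> chart_dom c" "N s < 1/2" for s
  proof -
    have "(x0, x s) \<in> prod_dom" unfolding x_def by (rule one_mem_prod_dom[OF s(1)])
    then have "bounded_linear (frechet_derivative prod_map (at (x0, x s)))"
      using prod_map_has_derivative has_derivative_bounded_linear by blast
    moreover have "bounded_linear (\<lambda>u::'e. (u, 0::'e))"
      by (intro bounded_linear_Pair bounded_linear_ident bounded_linear_zero)
    ultimately have lin: "bounded_linear (R (x s))"
      unfolding R_def by (rule bounded_linear_compose)
    define u where "u = K s - w"
    have "e s = R (x s) (K s) - R (x s) w"
      unfolding e_def K_def R_def x_def by (simp add: left_inv_field_Ad[OF s(1)])
    then have e: "e s = R (x s) u" using linear_simps(2)[OF lin] by (simp add: u_def)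
    have lin': "bounded_linear (\<lambda>u. R (x s) u - u)"
      by (intro bounded_linear_sub lin bounded_linear_ident)
    have "norm (R (x s) u - u) \<le> onorm (\<lambda>u. R (x s) u - u) * norm u" by (rule onorm[OF lin'])
    also have "\<dots> \<le> N s * norm u"
      unfolding N_def by (intro mult_right_mono onorm_componentwise lin') simp
    also have "\<dots> \<le> 1/2 * norm u" using s(2) by (intro mult_right_mono) auto
    finally show ?thesis
      using norm_triangle_ineq2[of u "u - R (x s) u"] e
      by (simp add: u_def[symmetric] norm_minus_commute)
  qed
  have "((\<lambda>s. norm (e s) / norm s) \<longlongrightarrow> 0) (at 0)"
    using e' e0 unfolding has_vector_derivative_def has_derivative_at by simp
  then have lim: "((\<lambda>s. 2 * (norm (e s) / norm s)) \<longlongrightarrow> 0) (at 0)"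
    using tendsto_mult_right_zero by blast
  have "((\<lambda>s. norm (K s - w) / norm s) \<longlongrightarrow> 0) (at 0)"
  proof (rule Lim_null_comparison[OF _ lim])
    show "eventually (\<lambda>s. norm (norm (K s - w) / norm s) \<le> 2 * (norm (e s) / norm s)) (at 0)"
      using near smallN
    proof eventually_elim
      case (elim s)
      then show ?case using K_le[of s] by (simp add: divide_right_mono)
    qed
  qed
  moreover have "K 0 = w" by (simp add: K_def \<gamma>0 Ad_one)
  ultimately have "(K has_vector_derivative 0) (at 0)"
    unfolding has_vector_derivative_def has_derivative_at by simp
  moreover have "K = (\<lambda>s. Ad G c (?\<gamma> s) w)" by (simp add: K_def fun_eq_iff)
  ultimately show ?thesis by simp
qed

text \<open>The derivative at any \<open>s\<close> reduces to the one at 0, because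
  \<open>Ad\<close> of \<open>exp_curve v (s + h)\<close> is the fixed linear map
  \<open>Ad G c (exp_curve v s)\<close> after \<open>Ad\<close> of
  \<open>exp_curve v h\<close>.\<close>

lemma Ad_exp_curve_fixed:
  assumes br: "lie_bracket G c v w = 0"
  shows "Ad G c (exp_curve v s) w = w"
proof -
  let ?K = "\<lambda>s. Ad G c (exp_curve v s) w"
  have "(?K has_vector_derivative 0) (at s within UNIV)" for s
  proof -
    have "((\<lambda>h. Ad G c (exp_curve v s) (?K h)) has_vector_derivative Ad G c (exp_curve v s) 0) (at 0)"
      by (rule bounded_linear.has_vector_derivative[OF Ad_linear Ad_exp_curve_has_vector_derivative_0[OF br]])
    moreover have "Ad G c (exp_curve v s) 0 = 0" by (rule linear_simps(3)[OF Ad_linear])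
    moreover have "(\<lambda>h. Ad G c (exp_curve v s) (?K h)) = (\<lambda>h. ?K (s + h))"
      by (simp only: exp_curve_add Ad_mult)
    ultimately have 1: "((\<lambda>h. ?K (s + h)) has_vector_derivative 0) (at (s - s))" by simp
    have 2: "((\<lambda>u. u - s) has_vector_derivative 1) (at s)"
      by (auto intro!: derivative_eq_intros simp flip: has_real_derivative_iff_has_vector_derivative)
    from vector_diff_chain_at[OF 2 1] show ?thesis by (simp add: o_def)
  qed
  then obtain k where "\<And>s. ?K s = k"
    using has_vector_derivative_zero_constant[OF convex_UNIV, of ?K] by (metis UNIV_I)
  from this[of s] this[of 0] show ?thesis by (simp add: exp_curve_props Ad_one)
qed

text \<open>The pointwise product of the two commuting one-parameter subgroups has constant velocity
  \<open>v + w\<close>; uniqueness identifies it with the curve of \<open>v + w\<close>.\<close>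

lemma lie_exp_add:
  assumes br: "lie_bracket G c v w = 0"
  shows "lie_exp G A c (v + w) = lie_exp G A c v \<otimes> lie_exp G A c w"
proof -
  have com: "exp_curve v s \<otimes> exp_curve w t = exp_curve w t \<otimes> exp_curve v s" for s t
  proof -
    have "exp_curve w t = lie_exp G A c (t *\<^sub>R Ad G c (exp_curve v s) w)"
      by (simp add: lie_exp_scaleR Ad_exp_curve_fixed[OF br])
    also have "\<dots> = lie_exp G A c (Ad G c (exp_curve v s) (t *\<^sub>R w))"
      using linear_simps(5)[OF Ad_linear] by simp
    also have "\<dots> = exp_curve v s \<otimes> exp_curve w t \<otimes> inv (exp_curve v s)"
      by (simp add: lie_exp_conj[symmetric] lie_exp_scaleR)
    finally have "exp_curve w t \<otimes> exp_curve v s = exp_curve v s \<otimes> exp_curve w t \<otimes> inv (exp_curve v s) \<otimes> exp_curve v s"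
      by simp
    then show ?thesis by (simp add: m_assoc)
  qed
  \<comment> \<open>The velocity of the product needs \<open>Ad\<close> of the other subgroup to fix
    \<open>v\<close>. Commutation being symmetric, \<open>v\<close> and its image under
    \<open>Ad\<close> have the same exponential curve, hence the same derivative at 0.\<close>
  have fixed: "Ad G c (inv (exp_curve w t)) v = v" for t
  proof -
    have "exp_curve v s = lie_exp G A c (s *\<^sub>R Ad G c (inv (exp_curve w t)) v)" for s
    proof -
      have "exp_curve v s = inv (exp_curve w t) \<otimes> exp_curve v s \<otimes> inv (inv (exp_curve w t))"
        by (simp add: m_assoc com)
      also have "\<dots> = lie_exp G A c (Ad G c (inv (exp_curve w t)) (s *\<^sub>R v))"
        by (simp add: lie_exp_scaleR lie_exp_conj[symmetric] )
      finally show ?thesis using linear_simps(5)[OF Ad_linear] by simp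
    qed
    then have "exp_curve v = exp_curve (Ad G c (inv (exp_curve w t)) v)"
      by (simp add: fun_eq_iff lie_exp_scaleR)
    then show ?thesis
      using chart_exp_curve_has_vector_derivative vector_derivative_unique_at by metis
  qed
  have "is_exp_curve G A c (v + w) (\<lambda>t. exp_curve v t \<otimes> exp_curve w t)"
    unfolding is_exp_curve_iff
  proof (intro conjI allI)
    show "has_velocity (\<lambda>t. exp_curve v t \<otimes> exp_curve w t) (v + w) t" for t
      using has_velocity_mult[OF exp_curve_props(2,3) exp_curve_props(2,3), of v w t] fixed by simp
  qed (auto simp: exp_curve_props intro!: continuous_intros exp_curve_props)
  then show ?thesis unfolding lie_exp_eq using exp_curveI by metis
qed

text \<open>By \<open>lie_exp_add\<close>, on V the exponential is a finite product of one-parameter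
  subgroups, one for each coordinate in an orthonormal basis, and each of them is
  continuous.\<close>

lemma continuous_on_lie_exp:
  assumes V: "subspace V" and br: "\<And>v w. v \<in> V \<Longrightarrow> w \<in> V \<Longrightarrow> lie_bracket G c v w = 0"
  shows "continuous_on V (lie_exp G A c)"
proof -
  obtain B where B: "B \<subseteq> V" "pairwise orthogonal B" "\<And>x. x \<in> B \<Longrightarrow> norm x = 1" "independent B" "span B = V"
    using orthonormal_basis_subspace[OF V] by metis
  have fin: "finite B" using B(4) by (rule independent_imp_finite)
  \<comment> \<open>The coefficients \<open>q\<close> are functions on the whole type with the
    product topology, so the domain of \<open>F\<close> stays the same throughout the induction on
    \<open>C\<close>.\<close>
  have "\<exists>F. continuous_on UNIV F \<and> (\<forall>q. lie_exp G A c (\<Sum>b\<in>C. q b *\<^sub>R b) = F q)" if "finite C" "C \<subseteq> B" for C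
    using that
  proof (induction C)
    case empty
    then show ?case by (auto simp: lie_exp_0 intro!: exI[of _ "\<lambda>_. \<one>"])
  next
    case (insert b C)
    then obtain F where F: "continuous_on UNIV F" "\<And>q. lie_exp G A c (\<Sum>b\<in>C. q b *\<^sub>R b) = F q" by auto
    have "lie_exp G A c (\<Sum>b\<in>insert b C. q b *\<^sub>R b) = exp_curve b (q b) \<otimes> F q" for q
    proof -
      have "b \<in> V" "(\<Sum>b\<in>C. q b *\<^sub>R b) \<in> V"
        using insert.prems B V by (auto intro!: subspace_sum subspace_scale)
      then have "lie_exp G A c (q b *\<^sub>R b + (\<Sum>b\<in>C. q b *\<^sub>R b)) = exp_curve b (q b) \<otimes> F q"
        using V by (subst lie_exp_add) (auto simp: br subspace_scale lie_exp_scaleR F)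
      then show ?thesis using insert.hyps by simp
    qed
    moreover have "continuous_on UNIV (\<lambda>q. exp_curve b (q b) \<otimes> F q)"
      by (intro continuous_intros continuous_on_compose2[OF exp_curve_props(2)] F
          continuous_on_product_coordinates) auto
    ultimately show ?case by blast
  qed
  from this[OF fin subset_refl] obtain F where F: "continuous_on UNIV F" "\<And>q. lie_exp G A c (\<Sum>b\<in>B. q b *\<^sub>R b) = F q"
    by blast
  define T where "T x b = x \<bullet> b" for x b :: 'e
  have T: "(\<Sum>b\<in>B. T x b *\<^sub>R b) = x" if "x \<in> V" for x
  proof -
    define y where "y = (\<Sum>b\<in>B. T x b *\<^sub>R b)"
    have "y \<in> span B" unfolding y_def by (intro span_sum span_scale span_base)
    then have xy: "x - y \<in> span B" using that B(5) span_diff[of x B y] by simp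
    have "y = (\<Sum>b\<in>B. (b \<bullet> x / (b \<bullet> b)) *\<^sub>R b)"
      unfolding y_def T_def using B(3) by (intro sum.cong refl) (simp add: inner_commute dot_square_norm)
    then have "orthogonal (x - y) (x - y)"
      using Gram_Schmidt_step[OF B(2) xy, of x] by simp
    then show ?thesis by (simp add: y_def orthogonal_self)
  qed
  have "continuous_on V (\<lambda>x. F (T x))"
    by (rule continuous_on_compose2[OF F(1)])
       (auto intro!: continuous_on_coordinatewise_then_product continuous_intros simp: T_def)
  moreover have "lie_exp G A c x = F (T x)" if "x \<in> V" for x
    using F(2)[of "T x"] T[OF that] by simp
  ultimately show ?thesis by (simp cong: continuous_on_cong)
qed

end

subsection \<open>Averages over short intervals\<close>

text \<open>\<open>\<Psi>\<close> is smeared at scale \<open>\<epsilon>\<close>: the kernel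
  \<open>k s u\<close> admits centres \<open>s\<close> in [-1,1] within \<open>\<epsilon>\<close> of
  \<open>u\<close>, and Fubini turns the integral over \<open>u\<close> into one over
  \<open>s\<close> of the windows treated by \<open>step\<close>. The price is that \<open>s\<close>
  runs over an interval slightly larger than that of \<open>u\<close>; two intervals of half-length
  \<open>l\<close> cover it, which gives \<open>4 * l\<close>.\<close>

lemma averaging_step:
  fixes \<Phi> \<Psi> :: "real \<Rightarrow> ennreal" and \<epsilon> l l' P Q B s0 :: real
  assumes meas: "(\<lambda>s. \<Phi> s * indicator {-1..1} s) \<in> borel_measurable borel"
      "(\<lambda>s. \<Psi> s * indicator {-1..1} s) \<in> borel_measurable borel"
    and step: "\<And>s. s \<in> {-1..1} \<Longrightarrow>
      (\<integral>\<^sup>+r\<in>{-1..1}. \<Psi> (s + \<epsilon> * r) * indicator {-1..1} (s + \<epsilon> * r) \<partial>lborel) \<le> ennreal P * \<Phi> s + ennreal Q"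
    and avg: "\<And>s0. {s0 - l..s0 + l} \<subseteq> {-1..1} \<Longrightarrow> (\<integral>\<^sup>+s\<in>{s0 - l..s0 + l}. \<Phi> s \<partial>lborel) \<le> ennreal (2 * l * B)"
    and pos: "P \<ge> 0" "Q \<ge> 0" "B \<ge> 0" "0 < \<epsilon>" "\<epsilon> \<le> l" "0 < l'" "l' \<le> l" "l \<le> 1"
    and J: "{s0 - l'..s0 + l'} \<subseteq> {-1..1}"
  shows "(\<integral>\<^sup>+s\<in>{s0 - l'..s0 + l'}. \<Psi> s \<partial>lborel) \<le> ennreal (4 * l * (P * B + Q))"
proof -
  let ?W = "{-1..1::real}" and ?J = "{s0 - l'..s0 + l'}"
  \<comment> \<open>\<open>p\<close> and \<open>q\<close> delimit the centres that can see a point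
    of \<open>?J\<close>; the length is at most \<open>4 * l\<close> because \<open>l'\<close> and
    \<open>\<epsilon>\<close> are at most \<open>l\<close>.\<close>
  define p where "p = max (-1) (s0 - l' - \<epsilon>)"
  define q where "q = min 1 (s0 + l' + \<epsilon>)"
  have s0: "-1 \<le> s0 - l'" "s0 + l' \<le> 1" using J pos by auto
  have pq: "-1 \<le> p" "q \<le> 1" "p \<le> q" "q - p \<le> 4 * l" using s0 pos by (auto simp: p_def q_def)
  define \<psi> where "\<psi> u = \<Psi> u * indicator ?J u" for u
  define \<phi> where "\<phi> s = \<Phi> s * indicator ?W s" for s
  have \<phi>m [measurable]: "\<phi> \<in> borel_measurable borel" using meas(1) unfolding \<phi>_def[abs_def] .
  have "(\<lambda>s. (\<Psi> s * indicator ?W s) * indicator ?J s) \<in> borel_measurable borel"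
    using meas(2) by measurable
  moreover have "(\<lambda>s. (\<Psi> s * indicator ?W s) * indicator ?J s) = \<psi>"
    using J by (auto simp: \<psi>_def fun_eq_iff split: split_indicator)
  ultimately have \<psi>m [measurable]: "\<psi> \<in> borel_measurable borel" by simp
  define k where "k s u = (indicator (?W \<inter> {u - \<epsilon>..u + \<epsilon>}) s :: ennreal)" for s u
  have k_meas [measurable]: "(\<lambda>(u, s). k s u) \<in> borel_measurable (lborel \<Otimes>\<^sub>M lborel)"
  proof -
    have "(\<lambda>(u, s). k s u) = (\<lambda>z. indicator {z. snd z \<in> ?W \<and> fst z - \<epsilon> \<le> snd z \<and> snd z \<le> fst z + \<epsilon>} z)"
      by (auto simp: k_def fun_eq_iff split: split_indicator)
    then show ?thesis by simp
  qed
  have mass: "ennreal \<epsilon> \<le> (\<integral>\<^sup>+s. k s u \<partial>lborel)" if "u \<in> ?J" for u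
  proof -
    \<comment> \<open>Near an endpoint of [-1,1] the window is cut off, but the half pointing
      towards 0 always survives. So the mass is at least \<open>\<epsilon>\<close>, not
      \<open>2 * \<epsilon>\<close>.\<close>
    define a where "a = (if u \<le> 0 then u else u - \<epsilon>)"
    have "{a..a + \<epsilon>} \<subseteq> ?W \<inter> {u - \<epsilon>..u + \<epsilon>}" using that s0 pos by (auto simp: a_def)
    then have "emeasure lborel {a..a + \<epsilon>} \<le> emeasure lborel (?W \<inter> {u - \<epsilon>..u + \<epsilon>})"
      by (intro emeasure_mono) auto
    then show ?thesis using pos by (simp add: k_def)
  qed
  have inner: "(\<integral>\<^sup>+u. \<psi> u * k s u \<partial>lborel) \<le> ennreal \<epsilon> * ((ennreal P * \<phi> s + ennreal Q) * indicator {p..q} s)" for s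
  proof (cases "s \<in> {p..q}")
    case False
    have z: "(\<lambda>u. \<psi> u * k s u) = (\<lambda>_. 0)"
      using False by (auto simp: fun_eq_iff \<psi>_def k_def p_def q_def split: split_indicator)
    show ?thesis unfolding z by simp
  next
    case True
    then have sW: "s \<in> ?W" using pq by auto
    let ?h = "\<lambda>u. \<Psi> u * indicator ?W u * indicator {s - \<epsilon>..s + \<epsilon>} u"
    have hm: "?h \<in> borel_measurable borel" using meas(2) by measurable
    have "(\<integral>\<^sup>+u. \<psi> u * k s u \<partial>lborel) \<le> (\<integral>\<^sup>+u. ?h u \<partial>lborel)"
      using J by (intro nn_integral_mono) (auto simp: \<psi>_def k_def split: split_indicator)
    also have "\<dots> = ennreal \<epsilon> * (\<integral>\<^sup>+r. ?h (s + \<epsilon> * r) \<partial>lborel)"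
      using nn_integral_real_affine[of ?h \<epsilon> s] hm pos by simp
    also have "(\<integral>\<^sup>+r. ?h (s + \<epsilon> * r) \<partial>lborel) =
        (\<integral>\<^sup>+r\<in>{-1..1}. \<Psi> (s + \<epsilon> * r) * indicator {-1..1} (s + \<epsilon> * r) \<partial>lborel)"
    proof (rule nn_integral_cong)
      fix r
      have "(s + \<epsilon> * r \<in> {s - \<epsilon>..s + \<epsilon>}) = (r \<in> {-1..1})"
      proof -
        have "s - \<epsilon> \<le> s + \<epsilon> * r \<longleftrightarrow> \<epsilon> * (- 1) \<le> \<epsilon> * r" "s + \<epsilon> * r \<le> s + \<epsilon> \<longleftrightarrow> \<epsilon> * r \<le> \<epsilon> * 1" by auto
        then show ?thesis unfolding atLeastAtMost_iff using mult_le_cancel_left_pos[OF pos(4)] by metis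
      qed
      then show "?h (s + \<epsilon> * r) = \<Psi> (s + \<epsilon> * r) * indicator {-1..1} (s + \<epsilon> * r) * indicator {-1..1} r"
        by (simp add: indicator_def)
    qed
    also have "\<dots> \<le> ennreal P * \<phi> s + ennreal Q" using step[OF sW] sW by (simp add: \<phi>_def)
    finally show ?thesis using True by (simp add: mult_left_mono)
  qed
  have "ennreal \<epsilon> * (\<integral>\<^sup>+u. \<psi> u \<partial>lborel) = (\<integral>\<^sup>+u. \<psi> u * ennreal \<epsilon> \<partial>lborel)"
    by (subst nn_integral_cmult[symmetric]) (simp_all add: mult.commute)
  also have "\<dots> \<le> (\<integral>\<^sup>+u. \<psi> u * (\<integral>\<^sup>+s. k s u \<partial>lborel) \<partial>lborel)"
  proof (rule nn_integral_mono)
    show "\<psi> u * ennreal \<epsilon> \<le> \<psi> u * (\<integral>\<^sup>+s. k s u \<partial>lborel)" for u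
      by (cases "u \<in> ?J") (auto simp: \<psi>_def intro!: mult_left_mono mass)
  qed
  also have "\<dots> = (\<integral>\<^sup>+u. (\<integral>\<^sup>+s. \<psi> u * k s u \<partial>lborel) \<partial>lborel)"
    by (intro nn_integral_cong nn_integral_cmult[symmetric]) (simp add: k_def)
  also have "\<dots> = (\<integral>\<^sup>+s. (\<integral>\<^sup>+u. \<psi> u * k s u \<partial>lborel) \<partial>lborel)"
  proof (rule lborel_pair.Fubini'[symmetric])
    have "(\<lambda>z. \<psi> (fst z) * (\<lambda>(u, s). k s u) z) \<in> borel_measurable (lborel \<Otimes>\<^sub>M lborel)"
      using k_meas by measurable
    then show "(\<lambda>(u, s). \<psi> u * k s u) \<in> borel_measurable (lborel \<Otimes>\<^sub>M lborel)"
      by (simp add: case_prod_beta')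
  qed
  also have "\<dots> \<le> (\<integral>\<^sup>+s. ennreal \<epsilon> * ((ennreal P * \<phi> s + ennreal Q) * indicator {p..q} s) \<partial>lborel)"
    by (intro nn_integral_mono inner)
  also have "\<dots> = ennreal \<epsilon> * (\<integral>\<^sup>+s\<in>{p..q}. (ennreal P * \<phi> s + ennreal Q) \<partial>lborel)"
    by (rule nn_integral_cmult) measurable
  finally have "(\<integral>\<^sup>+u. \<psi> u \<partial>lborel) \<le> (\<integral>\<^sup>+s\<in>{p..q}. (ennreal P * \<phi> s + ennreal Q) \<partial>lborel)"
    using pos by (simp add: ennreal_mult_le_mult_iff)
  also have "\<dots> = (\<integral>\<^sup>+s. ennreal P * (\<phi> s * indicator {p..q} s) + ennreal Q * indicator {p..q} s \<partial>lborel)"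
    by (simp add: distrib_right mult.assoc)
  also have "\<dots> = ennreal P * (\<integral>\<^sup>+s\<in>{p..q}. \<phi> s \<partial>lborel) + ennreal Q * emeasure lborel {p..q}"
    by (simp add: nn_integral_add nn_integral_cmult)
  also have "\<dots> \<le> ennreal P * ennreal (2 * (2 * l * B)) + ennreal Q * ennreal (4 * l)"
  proof (intro add_mono mult_left_mono)
    \<comment> \<open>One interval starts at \<open>p\<close>, the other ends at \<open>q\<close>.
      If either would leave [-1,1], the \<open>min\<close> or \<open>max\<close> slides it back
      inside, as \<open>avg\<close> requires.\<close>
    define a where "a = min p (1 - 2 * l) + l"
    define b where "b = max q (- 1 + 2 * l) - l"
    have sub: "{p..q} \<subseteq> {a - l..a + l} \<union> {b - l..b + l}" "{a - l..a + l} \<subseteq> ?W" "{b - l..b + l} \<subseteq> ?W"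
      using pq pos by (auto simp: a_def b_def)
    have "(\<integral>\<^sup>+s\<in>{p..q}. \<phi> s \<partial>lborel) \<le>
        (\<integral>\<^sup>+s. \<phi> s * indicator {a - l..a + l} s + \<phi> s * indicator {b - l..b + l} s \<partial>lborel)"
      using sub(1) by (intro nn_integral_mono) (auto split: split_indicator)
    also have "\<dots> = (\<integral>\<^sup>+s\<in>{a - l..a + l}. \<phi> s \<partial>lborel) + (\<integral>\<^sup>+s\<in>{b - l..b + l}. \<phi> s \<partial>lborel)"
      by (rule nn_integral_add) measurable
    also have "\<dots> \<le> ennreal (2 * l * B) + ennreal (2 * l * B)"
    proof (rule add_mono)
      have "(\<integral>\<^sup>+s\<in>{d - l..d + l}. \<phi> s \<partial>lborel) \<le> ennreal (2 * l * B)" if "{d - l..d + l} \<subseteq> ?W" for d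
      proof -
        have "(\<integral>\<^sup>+s\<in>{d - l..d + l}. \<phi> s \<partial>lborel) = (\<integral>\<^sup>+s\<in>{d - l..d + l}. \<Phi> s \<partial>lborel)"
          using that by (intro nn_integral_cong) (auto simp: \<phi>_def split: split_indicator)
        with avg[OF that] show ?thesis by simp
      qed
      then show "(\<integral>\<^sup>+s\<in>{a - l..a + l}. \<phi> s \<partial>lborel) \<le> ennreal (2 * l * B)"
        and "(\<integral>\<^sup>+s\<in>{b - l..b + l}. \<phi> s \<partial>lborel) \<le> ennreal (2 * l * B)" using sub by blast+
    qed
    also have "\<dots> = ennreal (2 * (2 * l * B))" using pos by (simp flip: ennreal_plus)
    finally show "(\<integral>\<^sup>+s\<in>{p..q}. \<phi> s \<partial>lborel) \<le> ennreal (2 * (2 * l * B))" .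
    show "emeasure lborel {p..q} \<le> ennreal (4 * l)" using pq by (simp add: ennreal_leI)
  qed auto
  also have "\<dots> = ennreal (P * (2 * (2 * l * B)) + Q * (4 * l))"
    using pos by (simp flip: ennreal_mult ennreal_plus)
  also have "P * (2 * (2 * l * B)) + Q * (4 * l) = 4 * l * (P * B + Q)" by (simp add: algebra_simps)
  finally show ?thesis by (simp add: \<psi>_def)
qed

text \<open>Induction over time in steps of \<open>\<tau>\<close>, with one bound for all centres.
  The hypothesis on \<open>B\<close> says that the recursion does not increase it: 2 counts the
  covering intervals and \<open>exp (\<delta> * \<alpha> \<tau>)\<close> is the quotient of
  successive interval lengths.\<close>

lemma averages_bounded_by_iteration:
  fixes F :: "real \<Rightarrow> real \<Rightarrow> ennreal" and \<alpha> :: "real \<Rightarrow> real" and \<delta> P Q B \<tau> t0 :: real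
  assumes meas: "\<And>t. (\<lambda>s. F t s * indicator {-1..1} s) \<in> borel_measurable borel"
    and \<alpha>: "Modules.additive \<alpha>" "\<And>t. t > 0 \<Longrightarrow> \<alpha> t > 0"
    and \<delta>: "0 \<le> \<delta>" "\<delta> \<le> 1"
    and step: "\<And>t s. t0 \<le> t \<Longrightarrow> s \<in> {-1..1} \<Longrightarrow>
      (\<integral>\<^sup>+r\<in>{-1..1}. F (t + \<tau>) (s + exp (- \<alpha> t) * r) * indicator {-1..1} (s + exp (- \<alpha> t) * r) \<partial>lborel)
        \<le> ennreal P * F t s + ennreal Q"
    and init: "\<And>t s. 0 \<le> t \<Longrightarrow> t \<le> t0 + \<tau> \<Longrightarrow> s \<in> {-1..1} \<Longrightarrow> F t s \<le> ennreal B"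
    and pos: "P \<ge> 0" "Q \<ge> 0" "B \<ge> 0" "\<tau> > 0" "t0 \<ge> 0"
    and B: "2 * exp (\<delta> * \<alpha> \<tau>) * (P * B + Q) \<le> B"
    and t: "t \<ge> 0" "{s0 - exp (- \<delta> * \<alpha> t)..s0 + exp (- \<delta> * \<alpha> t)} \<subseteq> {-1..1}"
  shows "(\<integral>\<^sup>+s\<in>{s0 - exp (- \<delta> * \<alpha> t)..s0 + exp (- \<delta> * \<alpha> t)}. F t s \<partial>lborel) \<le> ennreal (2 * exp (- \<delta> * \<alpha> t) * B)"
proof -
  let ?l = "\<lambda>t. exp (- \<delta> * \<alpha> t)"
  interpret additive \<alpha> by fact
  have \<alpha>0: "\<alpha> u \<ge> 0" if "u \<ge> 0" for u
    using \<alpha>(2)[of u] that zero by (cases "u = 0") auto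
  \<comment> \<open>The base case reaches \<open>t0 + \<tau>\<close> instead of \<open>t0\<close>,
    so that for every later \<open>u\<close> the earlier time \<open>u - \<tau>\<close> is still at
    least \<open>t0\<close>, where \<open>step\<close> applies.\<close>
  have "(\<integral>\<^sup>+s\<in>{s0 - ?l u..s0 + ?l u}. F u s \<partial>lborel) \<le> ennreal (2 * ?l u * B)"
    if "u \<ge> 0" "u \<le> t0 + \<tau> + real n * \<tau>" "{s0 - ?l u..s0 + ?l u} \<subseteq> {-1..1}" for n u s0
    using that
  proof (induction n arbitrary: u s0)
    case 0
    have "(\<integral>\<^sup>+s\<in>{s0 - ?l u..s0 + ?l u}. F u s \<partial>lborel) \<le> (\<integral>\<^sup>+s\<in>{s0 - ?l u..s0 + ?l u}. ennreal B \<partial>lborel)"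
      using 0 by (intro nn_integral_mono) (auto intro!: init split: split_indicator)
    also have "\<dots> = ennreal B * ennreal (2 * ?l u)" by (simp add: nn_integral_cmult)
    also have "\<dots> = ennreal (2 * ?l u * B)" using pos by (simp add: mult.commute flip: ennreal_mult)
    finally show ?case .
  next
    case (Suc n)
    show ?case
    proof (cases "u \<le> t0 + \<tau> + real n * \<tau>")
      case True
      then show ?thesis using Suc by blast
    next
      case False
      define w where "w = u - \<tau>"
      have u: "u = w + \<tau>" by (simp add: w_def)
      have "real n * \<tau> \<ge> 0" "real (Suc n) * \<tau> = real n * \<tau> + \<tau>" using pos by (simp_all add: algebra_simps)
      then have w: "w \<ge> t0" "w \<ge> 0" "w \<le> t0 + \<tau> + real n * \<tau>"
        using False Suc.prems(2) pos unfolding u by linarith+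
      have aw: "\<alpha> w \<ge> 0" "\<alpha> \<tau> \<ge> 0" using \<alpha>0 w pos by auto
      have "(\<integral>\<^sup>+s\<in>{s0 - ?l u..s0 + ?l u}. F u s \<partial>lborel) \<le> ennreal (4 * ?l w * (P * B + Q))"
      proof (rule averaging_step[where \<epsilon> = "exp (- \<alpha> w)"])
        show "(\<lambda>s. F w s * indicator {-1..1} s) \<in> borel_measurable borel"
          "(\<lambda>s. F u s * indicator {-1..1} s) \<in> borel_measurable borel" by (rule meas)+
        show "(\<integral>\<^sup>+r\<in>{-1..1}. F u (s + exp (- \<alpha> w) * r) * indicator {-1..1} (s + exp (- \<alpha> w) * r) \<partial>lborel)
            \<le> ennreal P * F w s + ennreal Q" if "s \<in> {-1..1}" for s
          unfolding u by (rule step[OF w(1) that])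
        show "(\<integral>\<^sup>+s\<in>{s0 - ?l w..s0 + ?l w}. F w s \<partial>lborel) \<le> ennreal (2 * ?l w * B)"
          if "{s0 - ?l w..s0 + ?l w} \<subseteq> {-1..1}" for s0
          by (rule Suc.IH[OF w(2,3) that])
        have "\<delta> * \<alpha> w \<le> 1 * \<alpha> w" using \<delta> aw by (intro mult_right_mono) auto
        then show "exp (- \<alpha> w) \<le> ?l w" by simp
        have "\<delta> * \<alpha> w \<le> \<delta> * \<alpha> u" unfolding u add using \<delta> aw by (intro mult_left_mono) auto
        then show "?l u \<le> ?l w" by simp
        show "?l w \<le> 1" using \<delta> aw by simp
      qed (use pos Suc.prems in auto)
      also have "4 * ?l w * (P * B + Q) = 2 * ?l u * (2 * exp (\<delta> * \<alpha> \<tau>) * (P * B + Q))"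
      proof -
        have "?l w = ?l u * exp (\<delta> * \<alpha> \<tau>)" by (simp add: u add algebra_simps flip: exp_add)
        then show ?thesis by simp
      qed
      also have "ennreal \<dots> \<le> ennreal (2 * ?l u * B)"
        using B by (intro ennreal_leI mult_left_mono) auto
      finally show ?thesis .
    qed
  qed
  note * = this
  obtain n where "t / \<tau> \<le> real n" using real_arch_simple by blast
  then have "t \<le> t0 + \<tau> + real n * \<tau>" using pos by (simp add: field_simps)
  from *[OF t(1) this t(2)] show ?thesis .
qed


text \<open>Mean value inequality for \<open>\<phi> z - z *\<^sub>R curve_deriv \<phi> s\<close>
  between \<open>s\<close> and \<open>r\<close>: the Hoelder bound contributes the exponent
  \<open>\<gamma>\<close>, the length of the segment the exponent 1. The absolute value of
  \<open>C\<close> is used because \<open>C1_Holder\<close> does not ask for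
  \<open>C \<ge> 0\<close>.\<close>

lemma C1_Holder_taylor:
  assumes \<phi>: "C1_Holder \<gamma> \<phi>" and \<gamma>: "\<gamma> > 0"
  shows "\<exists>H\<ge>0. \<forall>s\<in>{-1..1}. \<forall>r\<in>{-1..1}.
    norm (\<phi> r - \<phi> s - (r - s) *\<^sub>R curve_deriv \<phi> s) \<le> H * \<bar>r - s\<bar> powr (1 + \<gamma>)"
proof -
  let ?W = "{-1..1::real}" and ?D = "curve_deriv \<phi>"
  obtain C where C: "\<And>s r. s \<in> ?W \<Longrightarrow> r \<in> ?W \<Longrightarrow> norm (?D s - ?D r) \<le> C * \<bar>s - r\<bar> powr \<gamma>"
    using \<phi> unfolding C1_Holder_def by blast
  have D: "(\<phi> has_vector_derivative ?D z) (at z within ?W)" if "z \<in> ?W" for z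
    using \<phi> that unfolding C1_Holder_def curve_deriv_def vector_derivative_works by blast
  have "norm (\<phi> r - \<phi> s - (r - s) *\<^sub>R ?D s) \<le> \<bar>C\<bar> * \<bar>r - s\<bar> powr (1 + \<gamma>)"
    if s: "s \<in> ?W" and r: "r \<in> ?W" for s r
  proof -
    let ?T = "closed_segment s r"
    define \<psi> where "\<psi> z = \<phi> z - z *\<^sub>R ?D s" for z
    have T: "?T \<subseteq> ?W" using s r by (intro closed_segment_subset) auto
    have "norm (\<psi> r - \<psi> s) \<le> (\<bar>C\<bar> * \<bar>r - s\<bar> powr \<gamma>) * norm (r - s)"
    proof (rule differentiable_bound)
      fix z assume z: "z \<in> ?T"
      then have zW: "z \<in> ?W" using T by blast
      show "(\<psi> has_derivative (\<lambda>h. h *\<^sub>R (?D z - ?D s))) (at z within ?T)"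
        unfolding \<psi>_def has_vector_derivative_def[symmetric]
        by (auto intro!: derivative_eq_intros has_vector_derivative_within_subset[OF D[OF zW] T]
            simp flip: has_real_derivative_iff_has_vector_derivative)
      have "\<bar>z - s\<bar> \<le> \<bar>r - s\<bar>"
        using z unfolding closed_segment_eq_real_ivl by (auto split: if_splits)
      then have "\<bar>z - s\<bar> powr \<gamma> \<le> \<bar>r - s\<bar> powr \<gamma>" using \<gamma> by (intro powr_mono2) auto
      then have "\<bar>C\<bar> * \<bar>z - s\<bar> powr \<gamma> \<le> \<bar>C\<bar> * \<bar>r - s\<bar> powr \<gamma>" by (intro mult_left_mono) auto
      moreover have "C * \<bar>z - s\<bar> powr \<gamma> \<le> \<bar>C\<bar> * \<bar>z - s\<bar> powr \<gamma>" by (intro mult_right_mono) auto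
      ultimately have "norm (?D z - ?D s) \<le> \<bar>C\<bar> * \<bar>r - s\<bar> powr \<gamma>" using C[OF zW s] by linarith
      then show "onorm (\<lambda>h. h *\<^sub>R (?D z - ?D s)) \<le> \<bar>C\<bar> * \<bar>r - s\<bar> powr \<gamma>"
        by (intro onorm_le) (simp add: mult.commute mult_left_mono)
    qed auto
    moreover have "\<psi> r - \<psi> s = \<phi> r - \<phi> s - (r - s) *\<^sub>R ?D s" by (simp add: \<psi>_def algebra_simps)
    moreover have "\<bar>r - s\<bar> powr \<gamma> * norm (r - s) = \<bar>r - s\<bar> powr (1 + \<gamma>)"
      by (cases "r = s") (simp_all add: powr_add)
    ultimately show ?thesis by (simp add: mult.assoc)
  qed
  then show ?thesis by (intro exI[of _ "\<bar>C\<bar>"]) auto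
qed

text \<open>The component \<open>z\<close> of the derivative orthogonal to V vanishes, since the
  inner product of \<open>\<phi>\<close> with \<open>z\<close> is identically 0 on [-1,1].\<close>

lemma curve_deriv_in_subspace:
  assumes \<phi>: "\<phi> differentiable (at s within {-1..1})" and s: "s \<in> {-1..1}"
    and V: "subspace V" "\<phi> ` {-1..1} \<subseteq> V"
  shows "curve_deriv \<phi> s \<in> V"
proof -
  have D: "(\<phi> has_vector_derivative curve_deriv \<phi> s) (at s within {-1..1})"
    using \<phi> unfolding curve_deriv_def vector_derivative_works by blast
  obtain y z where yz: "y \<in> span V" "\<And>w. w \<in> span V \<Longrightarrow> orthogonal z w" "curve_deriv \<phi> s = y + z"
    using orthogonal_subspace_decomp_exists by metis
  have sp: "span V = V" using V(1) by (simp add: span_eq_iff)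
  have "((\<lambda>r. \<phi> r \<bullet> z) has_vector_derivative curve_deriv \<phi> s \<bullet> z) (at s within cbox (-1) 1)"
    using bounded_linear.has_vector_derivative[OF bounded_linear_inner_left D, of z] by simp
  moreover have "((\<lambda>r. \<phi> r \<bullet> z) has_vector_derivative 0) (at s within cbox (-1) 1)"
  proof (rule has_vector_derivative_transform[OF _ _ has_vector_derivative_const])
    show "\<phi> r \<bullet> z = 0" if "r \<in> cbox (-1) 1" for r
    proof -
      have "r \<in> {-1..1}" using that by simp
      then have "\<phi> r \<in> span V" unfolding sp using V(2) by blast
      then show ?thesis using yz(2)[of "\<phi> r"] by (simp add: orthogonal_def inner_commute)
    qed
  qed (use s in auto)
  ultimately have "curve_deriv \<phi> s \<bullet> z = 0"
    using s by (intro vector_derivative_unique_within_closed_interval[of "-1" 1 s "\<lambda>r. \<phi> r \<bullet> z"]) auto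
  moreover have "y \<bullet> z = 0" using yz(2)[OF yz(1)] by (simp add: orthogonal_def inner_commute)
  ultimately have "z = 0" using yz(3) by (simp add: inner_add_left)
  then show ?thesis using yz sp by simp
qed

section \<open>Bounds for the averages from the contraction hypothesis\<close>

context lie_group_chart begin

lemma compact_identity_neighbourhood: "\<exists>N. compact N \<and> \<one> \<in> interior N"
proof -
  obtain r where r: "r > 0" "cball x0 r \<subseteq> chart_map c ` chart_dom c"
    using open_contains_cball chart_props(2)[OF c] one_dom by blast
  let ?N = "chart_inv c ` cball x0 r"
  let ?O = "chart_map c -` ball x0 r \<inter> chart_dom c"
  have "compact ?N"
    by (intro compact_continuous_image continuous_on_subset[OF chart_props(4)[OF c] r(2)]) auto
  moreover have "open ?O"
    using continuous_on_open_vimage[OF chart_props(1)[OF c]] chart_props(3)[OF c] by blast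
  moreover have "?O \<subseteq> ?N"
  proof
    fix p assume "p \<in> ?O"
    then have "p = chart_inv c (chart_map c p)" "chart_map c p \<in> cball x0 r"
      using chart_props(5)[OF c] by auto
    then show "p \<in> ?N" by blast
  qed
  moreover have "\<one> \<in> ?O" using r one_dom by simp
  ultimately show ?thesis using interiorI by blast
qed

text \<open>The hypothesis on \<open>f\<close> concerns neighbourhoods of the identity; adjoining a
  compact one to \<open>K\<close> makes it apply to arbitrary compact sets.\<close>

lemma height_compact_bound:
  assumes hf: "height_function G A c act g \<alpha> \<phi> \<beta> f" and K: "compact K"
  shows "\<exists>C::real. C \<ge> 1 \<and> (\<forall>h\<in>K. \<forall>x. f (act h x) \<le> ennreal C * f x)"
proof -
  obtain N where N: "compact N" "\<one> \<in> interior N" using compact_identity_neighbourhood by blast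
  have "compact (K \<union> N)" using K N(1) by (rule compact_Un)
  then have "compact (closure (K \<union> N))"
    using closure_closed[OF compact_imp_closed] by metis
  moreover have "\<one> \<in> interior (K \<union> N)" using N(2) interior_mono[of N "K \<union> N"] by blast
  ultimately show ?thesis
    using hf unfolding height_function_def by (metis UnI1)
qed

text \<open>The constants are fixed in the order \<open>C1\<close>, \<open>\<tau>\<close>, then
  \<open>b\<close> and \<open>t0\<close>, then \<open>CT\<close>, then \<open>B\<close>. Only the
  last choice involves \<open>M\<close>, and the base point enters only through
  \<open>f x \<le> ennreal M\<close>; this is the source of uniformity.\<close>

lemma sup_average_bounded:
  fixes act :: "'g \<Rightarrow> 'x::metric_space \<Rightarrow> 'x" and f :: "'x \<Rightarrow> ennreal"
  assumes act: "continuous_action G act" and g: "one_parameter_subgroup G g"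
    and adm: "admissible G c g \<alpha> \<phi>" and hf: "height_function G A c act g \<alpha> \<phi> \<beta> f"
    and \<delta>: "0 \<le> \<delta>" "\<delta> < \<beta>" and M: "M \<ge> 0"
  shows "\<exists>B::real. \<forall>x. f x \<le> ennreal M \<longrightarrow> sup_average G A c act g \<alpha> \<phi> \<delta> f x \<le> ennreal B"
proof -
  let ?W = "{-1..1::real}" and ?E = "lie_exp G A c" and ?D = "curve_deriv \<phi>"
  obtain \<gamma> where \<gamma>: "\<gamma> > 0" "C1_Holder \<gamma> \<phi>" using adm unfolding admissible_def by blast
  have \<alpha>: "Modules.additive \<alpha>" "\<And>t. t > 0 \<Longrightarrow> \<alpha> t > 0" using adm unfolding admissible_def by auto
  interpret \<alpha>: additive \<alpha> by (rule \<alpha>)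
  have \<alpha>_nonneg: "\<alpha> t \<ge> 0" if "t \<ge> 0" for t
    using \<alpha>(2)[of t] that \<alpha>.zero by (cases "t = 0") auto
  have \<alpha>_mono: "\<alpha> s \<le> \<alpha> t" if "s \<le> t" for s t
    using \<alpha>_nonneg[of "t - s"] that by (simp add: \<alpha>.diff)
  \<comment> \<open>Values at natural numbers together with monotonicity give all the growth of
    \<open>\<alpha>\<close> that is used; for this reason \<open>\<tau>\<close> and
    \<open>t0\<close> are chosen as natural numbers.\<close>
  have \<alpha>_nat: "\<alpha> (real n) = real n * \<alpha> 1" for n
    by (induction n) (simp_all add: \<alpha>.zero \<alpha>.add algebra_simps)
  have \<alpha>1: "\<alpha> 1 > 0" by (rule \<alpha>) simp
  have "\<exists>V. subspace V \<and> V \<subseteq> weight_space G c g \<alpha> \<and> \<phi> ` ?W \<subseteq> V \<and>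
      (\<forall>v\<in>V. \<forall>w\<in>V. lie_bracket G c v w = 0)"
    using adm unfolding admissible_def by (elim conjE)
  then obtain V where V: "subspace V" "V \<subseteq> weight_space G c g \<alpha>" "\<phi> ` ?W \<subseteq> V"
    and V0: "\<forall>v\<in>V. \<forall>w\<in>V. lie_bracket G c v w = 0"
    by (elim exE conjE)
  have br: "lie_bracket G c v w = 0" if "v \<in> V" "w \<in> V" for v w
    using V0 that by simp
  have \<phi>_diff: "\<phi> differentiable (at s within ?W)" if "s \<in> ?W" for s
    using conjunct1[OF \<gamma>(2)[unfolded C1_Holder_def]] that by (rule bspec)
  have \<phi>V: "\<phi> s \<in> V" if "s \<in> ?W" for s using V(3) imageI[OF that] by (rule subsetD)
  have DV: "?D s \<in> V" if "s \<in> ?W" for s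
    by (rule curve_deriv_in_subspace[OF \<phi>_diff[OF that] that V(1,3)])
  have cont\<phi>: "continuous_on ?W \<phi>"
    unfolding continuous_on_eq_continuous_within
    by (intro ballI differentiable_imp_continuous_within \<phi>_diff)
  have actm: "act (h \<otimes> k) x = act h (act k x)" for h k x
  proof -
    have "group_action G UNIV act" using act unfolding continuous_action_def by blast
    then show ?thesis by (rule group_action.composition_rule) auto
  qed
  have act_cont: "continuous_on UNIV (\<lambda>(h, x). act h x)"
    using act unfolding continuous_action_def by blast
  have g_cont: "continuous_on UNIV g" and g_add: "\<And>s t. g (s + t) = g s \<otimes> g t"
    using g unfolding one_parameter_subgroup_def by blast+
  have E_cont: "continuous_on V ?E" by (rule continuous_on_lie_exp[OF V(1) br])
  have E_add: "?E (v + w) = ?E v \<otimes> ?E w" if "v \<in> V" "w \<in> V" for v w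
    by (rule lie_exp_add[OF br[OF that]])
  have E_conj: "g t \<otimes> ?E v = ?E (exp (\<alpha> t) *\<^sub>R v) \<otimes> g t" if "v \<in> V" for v t
  proof -
    have "Ad G c (g t) v = exp (\<alpha> t) *\<^sub>R v" using V(2) that unfolding weight_space_def by blast
    then have "?E (exp (\<alpha> t) *\<^sub>R v) \<otimes> g t = (g t \<otimes> ?E v \<otimes> inv (g t)) \<otimes> g t"
      by (simp add: lie_exp_conj)
    then show ?thesis by (simp add: m_assoc)
  qed
  define F where "F x t s = f (act (g t \<otimes> ?E (\<phi> s)) x)" for x t s
  have f_meas: "f \<in> borel_measurable borel" using hf unfolding height_function_def by blast
  \<comment> \<open>\<open>\<phi>\<close> is controlled only on [-1,1], hence the indicator: there
    the orbit map is continuous, and \<open>f\<close> is Borel.\<close>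
  have F_meas: "(\<lambda>s. F x t s * indicator ?W s) \<in> borel_measurable borel" for x t
  proof -
    have "continuous_on ?W (\<lambda>s. g t \<otimes> ?E (\<phi> s))"
      by (intro continuous_intros continuous_on_compose2[OF E_cont cont\<phi> V(3)])
    then have "continuous_on ?W (\<lambda>s. act (g t \<otimes> ?E (\<phi> s)) x)"
      using continuous_on_compose2[OF act_cont, of ?W "\<lambda>s. (g t \<otimes> ?E (\<phi> s), x)"]
      by (simp add: continuous_on_Pair)
    then have "(\<lambda>s. act (g t \<otimes> ?E (\<phi> s)) x) \<in> measurable (restrict_space borel ?W) borel"
      by (rule borel_measurable_continuous_on_restrict)
    from measurable_compose[OF this f_meas] show ?thesis
      by (simp add: F_def borel_measurable_restrict_space_iff_ennreal)
  qed
  have bounded_exp: "\<exists>C::real. C \<ge> 1 \<and> (\<forall>v\<in>V. norm v \<le> R \<longrightarrow> (\<forall>x. f (act (?E v) x) \<le> ennreal C * f x))" for R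
  proof -
    have "compact (?E ` (V \<inter> cball 0 R))"
      by (intro compact_continuous_image continuous_on_subset[OF E_cont] closed_Int_compact closed_subspace V) auto
    from height_compact_bound[OF hf this] show ?thesis by auto
  qed
  obtain C1 where C1: "C1 \<ge> 1" "\<And>v x. v \<in> V \<Longrightarrow> norm v \<le> 1 \<Longrightarrow> f (act (?E v) x) \<le> ennreal C1 * f x"
    using bounded_exp[of 1] by blast
  obtain H where H: "H \<ge> 0" "\<And>s r. s \<in> ?W \<Longrightarrow> r \<in> ?W \<Longrightarrow>
      norm (\<phi> r - \<phi> s - (r - s) *\<^sub>R ?D s) \<le> H * \<bar>r - s\<bar> powr (1 + \<gamma>)"
    using C1_Holder_taylor[OF \<gamma>(2,1)] by blast
  have "\<exists>a::real. a \<ge> 1 \<and> (\<forall>t>0. \<exists>b::real. b > 0 \<and> (\<forall>x. \<forall>s\<in>?W.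
      ennreal (1/2) * (\<integral>\<^sup>+r\<in>?W. f (act (g t \<otimes> ?E (r *\<^sub>R ?D s)) x) \<partial>lborel)
        \<le> ennreal (a * exp (- \<beta> * \<alpha> t)) * f x + ennreal b))"
    using hf unfolding height_function_def by (elim conjE)
  then obtain a where a: "a \<ge> 1" and contraction: "\<forall>t>0. \<exists>b::real. b > 0 \<and> (\<forall>x. \<forall>s\<in>?W.
      ennreal (1/2) * (\<integral>\<^sup>+r\<in>?W. f (act (g t \<otimes> ?E (r *\<^sub>R ?D s)) x) \<partial>lborel)
        \<le> ennreal (a * exp (- \<beta> * \<alpha> t)) * f x + ennreal b)"
    by (elim exE conjE)
  \<comment> \<open>The iteration always runs with this exponent, which is at most 1 and still below
    \<open>\<beta>\<close>.\<close>
  define \<delta>1 where "\<delta>1 = min \<delta> 1"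
  have \<delta>1: "0 \<le> \<delta>1" "\<delta>1 \<le> 1" "\<delta>1 < \<beta>" using \<delta> by (auto simp: \<delta>1_def)
  \<comment> \<open>The 8 is a product of three factors 2: from the two covering intervals, from
    undoing the 1/2 in the contraction hypothesis, and from the aim that the resulting factor be at
    most 1/2.\<close>
  obtain n where n: "n > 0" "exp ((\<delta>1 - \<beta>) * \<alpha> (real n)) \<le> 1 / (8 * C1 * a)"
  proof -
    obtain n where n: "real n \<ge> ln (8 * C1 * a) / ((\<beta> - \<delta>1) * \<alpha> 1)" using real_arch_simple by blast
    have "8 * C1 * a > 0" using C1 a by simp
    have "real (Suc n) \<ge> ln (8 * C1 * a) / ((\<beta> - \<delta>1) * \<alpha> 1)" using n by simp
    then have "ln (8 * C1 * a) \<le> real (Suc n) * ((\<beta> - \<delta>1) * \<alpha> 1)"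
      using \<alpha>1 \<delta>1 by (simp add: pos_divide_le_eq)
    then have "(\<delta>1 - \<beta>) * \<alpha> (real (Suc n)) \<le> - ln (8 * C1 * a)"
      unfolding \<alpha>_nat by (simp add: algebra_simps)
    then have "exp ((\<delta>1 - \<beta>) * \<alpha> (real (Suc n))) \<le> exp (- ln (8 * C1 * a))" by simp
    also have "\<dots> = 1 / (8 * C1 * a)" using \<open>8 * C1 * a > 0\<close> by (simp add: exp_minus inverse_eq_divide)
    finally show thesis using that[of "Suc n"] by blast
  qed
  define \<tau> where "\<tau> = real n"
  have \<tau>: "\<tau> > 0" using n by (simp add: \<tau>_def)
  obtain b where b: "b > 0" "\<And>x s. s \<in> ?W \<Longrightarrow>
      ennreal (1/2) * (\<integral>\<^sup>+r\<in>?W. f (act (g \<tau> \<otimes> ?E (r *\<^sub>R ?D s)) x) \<partial>lborel)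
        \<le> ennreal (a * exp (- \<beta> * \<alpha> \<tau>)) * f x + ennreal b"
    using contraction[rule_format, OF \<tau>] by blast
  \<comment> \<open>Chosen so that from time \<open>t0\<close> on the expanded Taylor error has norm
    at most 1, the radius for which \<open>C1\<close> was obtained. Adding 1 keeps the logarithm
    meaningful when \<open>H = 0\<close>.\<close>
  obtain m where m: "real m \<ge> ln (H * exp (\<alpha> \<tau>) + 1) / (\<gamma> * \<alpha> 1)" using real_arch_simple by blast
  define t0 where "t0 = real m"
  have t0: "t0 \<ge> 0" by (simp add: t0_def)
  have err: "H * exp (\<alpha> \<tau>) * exp (- \<gamma> * \<alpha> t) \<le> 1" if "t \<ge> t0" for t
  proof -
    have pos: "H * exp (\<alpha> \<tau>) + 1 > 0" using H(1) by (simp add: add_nonneg_pos)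
    have "ln (H * exp (\<alpha> \<tau>) + 1) \<le> real m * (\<gamma> * \<alpha> 1)"
      using m \<gamma>(1) \<alpha>1 by (simp add: pos_divide_le_eq)
    also have "\<dots> = \<gamma> * \<alpha> t0" by (simp add: t0_def \<alpha>_nat)
    also have "\<dots> \<le> \<gamma> * \<alpha> t" using \<gamma>(1) \<alpha>_mono[OF that] by simp
    finally have "exp (ln (H * exp (\<alpha> \<tau>) + 1)) \<le> exp (\<gamma> * \<alpha> t)" by simp
    then have "H * exp (\<alpha> \<tau>) \<le> exp (\<gamma> * \<alpha> t)" using pos by simp
    then have "H * exp (\<alpha> \<tau>) * exp (- \<gamma> * \<alpha> t) \<le> exp (\<gamma> * \<alpha> t) * exp (- \<gamma> * \<alpha> t)"
      by (intro mult_right_mono) auto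
    then show ?thesis by (simp flip: exp_add)
  qed
  have point: "F x (t + \<tau>) (s + exp (- \<alpha> t) * r) \<le>
      ennreal C1 * f (act (g \<tau> \<otimes> ?E (r *\<^sub>R ?D s)) (act (g t \<otimes> ?E (\<phi> s)) x))"
    if t: "t \<ge> t0" and s: "s \<in> ?W" and r: "r \<in> ?W" and sr: "s + exp (- \<alpha> t) * r \<in> ?W" for x t s r
  proof -
    define \<epsilon> where "\<epsilon> = exp (- \<alpha> t)"
    define s' where "s' = s + \<epsilon> * r"
    define w where "w = \<phi> s' - \<phi> s - (s' - s) *\<^sub>R ?D s"
    have s': "s' \<in> ?W" using sr by (simp add: s'_def \<epsilon>_def)
    have wV: "w \<in> V" unfolding w_def using V(1) \<phi>V[OF s] \<phi>V[OF s'] DV[OF s]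
      by (intro subspace_diff subspace_scale)
    have rV: "q *\<^sub>R ?D s \<in> V" for q using V(1) DV[OF s] by (rule subspace_scale)
    have "\<phi> s' = w + ((\<epsilon> * r) *\<^sub>R ?D s + \<phi> s)" by (simp add: w_def s'_def)
    also have "?E \<dots> = ?E w \<otimes> (?E ((\<epsilon> * r) *\<^sub>R ?D s) \<otimes> ?E (\<phi> s))"
      using E_add wV rV \<phi>V[OF s] V(1) by (simp add: subspace_add)
    finally have "g (t + \<tau>) \<otimes> ?E (\<phi> s') = (g (t + \<tau>) \<otimes> ?E w) \<otimes> (?E ((\<epsilon> * r) *\<^sub>R ?D s) \<otimes> ?E (\<phi> s))"
      by (simp add: m_assoc)
    also have "\<dots> = ?E (exp (\<alpha> (t + \<tau>)) *\<^sub>R w) \<otimes> (g \<tau> \<otimes> ((g t \<otimes> ?E ((\<epsilon> * r) *\<^sub>R ?D s)) \<otimes> ?E (\<phi> s)))"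
      unfolding E_conj[OF wV] by (simp add: m_assoc g_add[of \<tau> t] add.commute[of t \<tau>])
    \<comment> \<open>The expansion by \<open>exp (\<alpha> t)\<close> cancels
      \<open>\<epsilon>\<close> exactly, so the first-order term becomes the unit-scale curve of the
      contraction hypothesis, whatever \<open>t\<close> is.\<close>
    also have "g t \<otimes> ?E ((\<epsilon> * r) *\<^sub>R ?D s) = ?E (r *\<^sub>R ?D s) \<otimes> g t"
    proof -
      have "exp (\<alpha> t) * (\<epsilon> * r) = (exp (\<alpha> t) * \<epsilon>) * r" by simp
      also have "exp (\<alpha> t) * \<epsilon> = 1" by (simp add: \<epsilon>_def flip: exp_add)
      finally have "exp (\<alpha> t) *\<^sub>R ((\<epsilon> * r) *\<^sub>R ?D s) = r *\<^sub>R ?D s"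
        by (simp only: scaleR_scaleR mult_1)
      then show ?thesis unfolding E_conj[OF rV] by (simp only:)
    qed
    finally have eq: "act (g (t + \<tau>) \<otimes> ?E (\<phi> s')) x = act (?E (exp (\<alpha> (t + \<tau>)) *\<^sub>R w))
        (act (g \<tau> \<otimes> ?E (r *\<^sub>R ?D s)) (act (g t \<otimes> ?E (\<phi> s)) x))"
      by (simp add: actm)
    have "norm w \<le> H * \<bar>\<epsilon> * r\<bar> powr (1 + \<gamma>)" using H(2)[OF s s'] by (simp add: w_def s'_def)
    also have "\<dots> \<le> H * \<epsilon> powr (1 + \<gamma>)"
    proof (intro mult_left_mono powr_mono2 H(1))
      have "\<epsilon> * \<bar>r\<bar> \<le> \<epsilon> * 1" using r by (intro mult_left_mono) (auto simp: \<epsilon>_def)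
      then show "\<bar>\<epsilon> * r\<bar> \<le> \<epsilon>" by (simp add: abs_mult \<epsilon>_def)
    qed (use \<gamma> in auto)
    also have "\<epsilon> powr (1 + \<gamma>) = exp (- \<alpha> t) * exp (- \<gamma> * \<alpha> t)"
      by (simp add: \<epsilon>_def powr_def algebra_simps flip: exp_add)
    finally have "exp (\<alpha> (t + \<tau>)) * norm w \<le> exp (\<alpha> (t + \<tau>)) * (H * (exp (- \<alpha> t) * exp (- \<gamma> * \<alpha> t)))"
      by (intro mult_left_mono) auto
    also have "\<dots> = H * exp (\<alpha> \<tau>) * exp (- \<gamma> * \<alpha> t)"
      by (simp add: \<alpha>.add exp_add exp_minus field_simps)
    also have "\<dots> \<le> 1" by (rule err[OF t])
    finally have "norm (exp (\<alpha> (t + \<tau>)) *\<^sub>R w) \<le> 1" by simp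
    from C1(2)[OF subspace_scale[OF V(1) wV] this] eq show ?thesis
      by (simp add: F_def s'_def \<epsilon>_def)
  qed
  define P where "P = 2 * C1 * a * exp (- \<beta> * \<alpha> \<tau>)"
  define Q where "Q = 2 * C1 * b"
  have PQ: "P \<ge> 0" "Q \<ge> 0" using C1 a b by (auto simp: P_def Q_def)
  have step: "(\<integral>\<^sup>+r\<in>?W. F x (t + \<tau>) (s + exp (- \<alpha> t) * r) * indicator ?W (s + exp (- \<alpha> t) * r) \<partial>lborel)
      \<le> ennreal P * F x t s + ennreal Q" if t: "t0 \<le> t" and s: "s \<in> ?W" for x t s
  proof -
    let ?y = "act (g t \<otimes> ?E (\<phi> s)) x"
    let ?I = "\<integral>\<^sup>+r\<in>?W. f (act (g \<tau> \<otimes> ?E (r *\<^sub>R ?D s)) ?y) \<partial>lborel"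
    have m: "(\<lambda>r. f (act (g \<tau> \<otimes> ?E (r *\<^sub>R ?D s)) ?y)) \<in> borel_measurable borel"
    proof -
      have "continuous_on UNIV (\<lambda>r. g \<tau> \<otimes> ?E (r *\<^sub>R ?D s))"
        unfolding lie_exp_scaleR by (intro continuous_intros exp_curve_props)
      then have "continuous_on UNIV (\<lambda>r. act (g \<tau> \<otimes> ?E (r *\<^sub>R ?D s)) ?y)"
        using continuous_on_compose2[OF act_cont, of UNIV "\<lambda>r. (g \<tau> \<otimes> ?E (r *\<^sub>R ?D s), ?y)"]
        by (simp add: continuous_on_Pair)
      from measurable_compose[OF borel_measurable_continuous_onI[OF this] f_meas] show ?thesis .
    qed
    have "(\<integral>\<^sup>+r\<in>?W. F x (t + \<tau>) (s + exp (- \<alpha> t) * r) * indicator ?W (s + exp (- \<alpha> t) * r) \<partial>lborel)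
        \<le> (\<integral>\<^sup>+r. ennreal C1 * (f (act (g \<tau> \<otimes> ?E (r *\<^sub>R ?D s)) ?y) * indicator ?W r) \<partial>lborel)"
      by (intro nn_integral_mono) (use point[OF t s] in \<open>auto split: split_indicator\<close>)
    also have "\<dots> = ennreal C1 * ?I"
      by (rule nn_integral_cmult) (use m in measurable)
    also have "?I = ennreal 2 * (ennreal (1/2) * ?I)"
    proof -
      have "ennreal 2 * ennreal (1/2) = 1" by (subst ennreal_mult[symmetric]) simp_all
      then show ?thesis by (simp only: mult.assoc[symmetric] mult_1)
    qed
    also have "ennreal C1 * \<dots> \<le> ennreal C1 * (ennreal 2 * (ennreal (a * exp (- \<beta> * \<alpha> \<tau>)) * f ?y + ennreal b))"
      by (intro mult_left_mono b(2)[OF s]) auto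
    also have "\<dots> = ennreal P * f ?y + ennreal Q"
    proof -
      have "ennreal P = ennreal C1 * (ennreal 2 * ennreal (a * exp (- \<beta> * \<alpha> \<tau>)))"
        using C1(1) a by (simp add: P_def mult_ac ennreal_mult)
      moreover have "ennreal Q = ennreal C1 * (ennreal 2 * ennreal b)"
        using C1(1) b(1) by (simp add: Q_def mult_ac ennreal_mult)
      ultimately show ?thesis by (simp only: distrib_left mult.assoc)
    qed
    finally show ?thesis by (simp add: F_def)
  qed
  \<comment> \<open>Up to time \<open>t0 + \<tau>\<close> the elements
    \<open>g t \<otimes> ?E (\<phi> s)\<close> form a compact set, which gives the initial bound of
    the iteration.\<close>
  obtain CT where CT: "CT \<ge> 1" "\<And>t s x. 0 \<le> t \<Longrightarrow> t \<le> t0 + \<tau> \<Longrightarrow> s \<in> ?W \<Longrightarrow> F x t s \<le> ennreal CT * f x"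
  proof -
    let ?K = "(\<lambda>(t, s). g t \<otimes> ?E (\<phi> s)) ` ({0..t0 + \<tau>} \<times> ?W)"
    have "continuous_on ({0..t0 + \<tau>} \<times> ?W) (\<lambda>z. g (fst z) \<otimes> ?E (\<phi> (snd z)))"
      by (intro continuous_intros continuous_on_compose2[OF g_cont] continuous_on_compose2[OF E_cont]
          continuous_on_compose2[OF cont\<phi>]) (use V(3) in auto)
    then have "compact ?K"
      by (intro compact_continuous_image compact_Times) (auto simp: case_prod_beta')
    from height_compact_bound[OF hf this] obtain C where C: "C \<ge> 1" "\<And>h x. h \<in> ?K \<Longrightarrow> f (act h x) \<le> ennreal C * f x"
      by blast
    show thesis
    proof (rule that[OF C(1)])
      fix t s x assume "0 \<le> t" "t \<le> t0 + \<tau>" "s \<in> ?W"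
      then have "g t \<otimes> ?E (\<phi> s) \<in> ?K" by (intro image_eqI[of _ _ "(t, s)"]) auto
      from C(2)[OF this] show "F x t s \<le> ennreal C * f x" by (simp add: F_def)
    qed
  qed
  let ?\<rho> = "exp (\<delta>1 * \<alpha> \<tau>)"
  \<comment> \<open>The first entry dominates the initial times; the second makes
    \<open>2 * ?\<rho> * Q\<close> at most half of \<open>B\<close>, the other half being left for
    the term with \<open>P\<close>.\<close>
  define B where "B = max (CT * M) (4 * ?\<rho> * Q)"
  have B: "B \<ge> 0" using M CT by (simp add: B_def le_max_iff_disj)
  have BP: "2 * ?\<rho> * (P * B + Q) \<le> B"
  proof -
    have "2 * ?\<rho> * P = 4 * C1 * a * exp ((\<delta>1 - \<beta>) * \<alpha> \<tau>)"
      by (simp add: P_def algebra_simps flip: exp_add)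
    also have "\<dots> \<le> 4 * C1 * a * (1 / (8 * C1 * a))"
      using n(2) C1 a unfolding \<tau>_def by (intro mult_left_mono) auto
    also have "\<dots> = 1/2" using C1 a by simp
    finally have "2 * ?\<rho> * P * B \<le> 1/2 * B" using B by (rule mult_right_mono)
    moreover have "2 * ?\<rho> * Q \<le> 1/2 * B" unfolding B_def by simp
    ultimately show ?thesis by (simp add: algebra_simps)
  qed
  have avg: "(\<integral>\<^sup>+s\<in>{s0 - exp (- \<delta>1 * \<alpha> t)..s0 + exp (- \<delta>1 * \<alpha> t)}. F x t s \<partial>lborel) \<le> ennreal (2 * exp (- \<delta>1 * \<alpha> t) * B)"
    if x: "f x \<le> ennreal M" and t: "t \<ge> 0" "{s0 - exp (- \<delta>1 * \<alpha> t)..s0 + exp (- \<delta>1 * \<alpha> t)} \<subseteq> ?W" for x t s0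
  proof (rule averages_bounded_by_iteration[where F = "F x" and P = P and Q = Q and \<tau> = \<tau> and ?t0.0 = t0])
    fix u s assume us: "0 \<le> u" "u \<le> t0 + \<tau>" "s \<in> ?W"
    have "F x u s \<le> ennreal CT * f x" by (rule CT(2)[OF us])
    also have "\<dots> \<le> ennreal CT * ennreal M" by (intro mult_left_mono x) simp
    also have "\<dots> = ennreal (CT * M)" using CT M by (simp add: ennreal_mult)
    also have "\<dots> \<le> ennreal B" by (intro ennreal_leI) (simp add: B_def)
    finally show "F x u s \<le> ennreal B" .
  qed (use F_meas \<alpha> \<delta>1 step PQ B \<tau> t0 BP t in auto)
  obtain B' :: real where B': "B' \<ge> 0" "\<And>x t s0. f x \<le> ennreal M \<Longrightarrow> t \<ge> 0 \<Longrightarrow> {s0 - exp (- \<delta> * \<alpha> t)..s0 + exp (- \<delta> * \<alpha> t)} \<subseteq> ?W \<Longrightarrow>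
      (\<integral>\<^sup>+s\<in>{s0 - exp (- \<delta> * \<alpha> t)..s0 + exp (- \<delta> * \<alpha> t)}. F x t s \<partial>lborel) \<le> ennreal (2 * exp (- \<delta> * \<alpha> t) * B')"
  proof (cases "\<delta> \<le> 1")
    case True
    then have "\<delta>1 = \<delta>" by (simp add: \<delta>1_def)
    then show ?thesis using that[OF B] avg by simp
  next
    case False
    then have \<delta>1_eq: "\<delta>1 = 1" by (simp add: \<delta>1_def)
    \<comment> \<open>Here the intervals are shorter than the scale that \<open>g t\<close> expands to unit size, on which
        the height is comparable to its average.\<close>
    obtain L where L: "L > 0" "\<And>s. s \<in> ?W \<Longrightarrow> norm (?D s) \<le> L"
    proof -
      obtain C where C: "\<And>s r. s \<in> ?W \<Longrightarrow> r \<in> ?W \<Longrightarrow> norm (?D s - ?D r) \<le> C * \<bar>s - r\<bar> powr \<gamma>"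
        using \<gamma>(2) unfolding C1_Holder_def by blast
      have "norm (?D s) \<le> norm (?D 0) + \<bar>C\<bar> + 1" if s: "s \<in> ?W" for s
      proof -
        have "C * \<bar>s - 0\<bar> powr \<gamma> \<le> \<bar>C\<bar> * \<bar>s - 0\<bar> powr \<gamma>" by (intro mult_right_mono) auto
        also have "\<dots> \<le> \<bar>C\<bar> * 1"
          using s \<gamma>(1) powr_mono2[of \<gamma> "\<bar>s\<bar>" 1] by (intro mult_left_mono) auto
        finally show ?thesis using C[OF s, of 0] norm_triangle_sub[of "?D s" "?D 0"] by simp
      qed
      moreover have "norm (?D 0) + \<bar>C\<bar> + 1 > 0" by (smt (verit) norm_ge_zero)
      ultimately show thesis using that by blast
    qed
    have lip: "norm (\<phi> s - \<phi> r) \<le> L * \<bar>s - r\<bar>" if "s \<in> ?W" "r \<in> ?W" for s r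
    proof -
      have "norm (\<phi> s - \<phi> r) \<le> L * norm (s - r)"
      proof (rule differentiable_bound[OF _ _ _ that(1,2)])
        fix z assume z: "z \<in> ?W"
        show "(\<phi> has_derivative (\<lambda>h. h *\<^sub>R ?D z)) (at z within ?W)"
          using \<phi>_diff[OF z] unfolding curve_deriv_def vector_derivative_works has_vector_derivative_def .
        show "onorm (\<lambda>h. h *\<^sub>R ?D z) \<le> L"
          using L(2)[OF z] by (intro onorm_le) (simp add: mult.commute[of L] mult_left_mono)
      qed simp
      then show ?thesis by simp
    qed
    \<comment> \<open>Points at distance up to \<open>2 * exp (- \<alpha> t)\<close> have images
      under \<open>\<phi>\<close> whose difference, expanded by \<open>exp (\<alpha> t)\<close>, has
      norm at most \<open>2 * L\<close>.\<close>
    obtain C2 where C2: "C2 \<ge> 1" "\<And>v x. v \<in> V \<Longrightarrow> norm v \<le> 2 * L \<Longrightarrow> f (act (?E v) x) \<le> ennreal C2 * f x"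
      using bounded_exp[of "2 * L"] by blast
    have comp: "F x t s \<le> ennreal C2 * F x t r"
      if "s \<in> ?W" "r \<in> ?W" "\<bar>s - r\<bar> \<le> 2 * exp (- \<alpha> t)" for x t s r
    proof -
      define v where "v = exp (\<alpha> t) *\<^sub>R (\<phi> s - \<phi> r)"
      have d: "\<phi> s - \<phi> r \<in> V" using V(1) \<phi>V that by (intro subspace_diff)
      have "norm (\<phi> s - \<phi> r) \<le> L * (2 * exp (- \<alpha> t))"
        using lip[OF that(1,2)] mult_left_mono[OF that(3), of L] L(1) by linarith
      then have "exp (\<alpha> t) * norm (\<phi> s - \<phi> r) \<le> exp (\<alpha> t) * (L * (2 * exp (- \<alpha> t)))"
        by (intro mult_left_mono) auto
      also have "\<dots> = 2 * L" by (simp add: exp_minus)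
      finally have "norm v \<le> 2 * L" by (simp only: v_def norm_scaleR abs_exp_cancel)
      moreover have "v \<in> V" unfolding v_def using V(1) d by (rule subspace_scale)
      moreover have "act (g t \<otimes> ?E (\<phi> s)) x = act (?E v) (act (g t \<otimes> ?E (\<phi> r)) x)"
      proof -
        have "?E (\<phi> s) = ?E (\<phi> s - \<phi> r) \<otimes> ?E (\<phi> r)" using E_add[OF d \<phi>V[OF that(2)]] by simp
        then have "g t \<otimes> ?E (\<phi> s) = (g t \<otimes> ?E (\<phi> s - \<phi> r)) \<otimes> ?E (\<phi> r)" by (simp add: m_assoc)
        also have "\<dots> = ?E v \<otimes> (g t \<otimes> ?E (\<phi> r))" unfolding E_conj[OF d] v_def by (simp add: m_assoc)
        finally show ?thesis by (simp add: actm)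
      qed
      ultimately show ?thesis using C2(2) by (simp add: F_def)
    qed
    have bound: "F x t s \<le> ennreal (C2 * B)" if x: "f x \<le> ennreal M" and t: "t \<ge> 0" and s: "s \<in> ?W" for x t s
    proof -
      define l where "l = exp (- \<alpha> t)"
      have l: "0 < l" "l \<le> 1" using \<alpha>_nonneg[OF t] by (auto simp: l_def)
      \<comment> \<open>Clamping the centre keeps the whole interval in [-1,1] and \<open>s\<close>
        inside it, though perhaps at an end. So distances up to \<open>2 * l\<close> occur, the
        range allowed in \<open>comp\<close>.\<close>
      define d where "d = max (-1 + l) (min (1 - l) s)"
      have dW: "{d - l..d + l} \<subseteq> ?W" and sd: "s \<in> {d - l..d + l}" using s l by (auto simp: d_def)
      have "F x t s * ennreal (2 * l) = (\<integral>\<^sup>+r\<in>{d - l..d + l}. F x t s \<partial>lborel)"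
        using l by (simp add: nn_integral_cmult)
      also have "\<dots> \<le> (\<integral>\<^sup>+r. ennreal C2 * ((F x t r * indicator ?W r) * indicator {d - l..d + l} r) \<partial>lborel)"
      proof (rule nn_integral_mono)
        fix r
        show "F x t s * indicator {d - l..d + l} r \<le> ennreal C2 * ((F x t r * indicator ?W r) * indicator {d - l..d + l} r)"
        proof (cases "r \<in> {d - l..d + l}")
          case True
          then have "\<bar>s - r\<bar> \<le> 2 * exp (- \<alpha> t)" using sd by (auto simp: l_def)
          moreover have "r \<in> ?W" using True dW by blast
          ultimately show ?thesis using comp[OF s, of r t x] True by simp
        qed simp
      qed
      also have "\<dots> = ennreal C2 * (\<integral>\<^sup>+r. (F x t r * indicator ?W r) * indicator {d - l..d + l} r \<partial>lborel)"
        by (rule nn_integral_cmult) (use F_meas[of x t] in measurable)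
      also have "(\<integral>\<^sup>+r. (F x t r * indicator ?W r) * indicator {d - l..d + l} r \<partial>lborel) = (\<integral>\<^sup>+r\<in>{d - l..d + l}. F x t r \<partial>lborel)"
        using dW by (intro nn_integral_cong) (auto split: split_indicator)
      also have "ennreal C2 * \<dots> \<le> ennreal C2 * ennreal (2 * l * B)"
        using avg[OF x t, of d] dW unfolding \<delta>1_eq l_def by (intro mult_left_mono) auto
      also have "\<dots> = ennreal (C2 * B) * ennreal (2 * l)"
        using C2 B l by (simp add: algebra_simps flip: ennreal_mult)
      finally show ?thesis
        using l ennreal_mult_le_mult_iff[of "ennreal (2 * l)" "F x t s" "ennreal (C2 * B)"]
        by (simp add: mult.commute)
    qed
    show ?thesis
    proof (rule that[of "C2 * B"])
      show "C2 * B \<ge> 0" using C2 B by simp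
      fix x t s0 assume x: "f x \<le> ennreal M" and t: "t \<ge> 0" and sub: "{s0 - exp (- \<delta> * \<alpha> t)..s0 + exp (- \<delta> * \<alpha> t)} \<subseteq> ?W"
      have "(\<integral>\<^sup>+s\<in>{s0 - exp (- \<delta> * \<alpha> t)..s0 + exp (- \<delta> * \<alpha> t)}. F x t s \<partial>lborel) \<le>
          (\<integral>\<^sup>+s\<in>{s0 - exp (- \<delta> * \<alpha> t)..s0 + exp (- \<delta> * \<alpha> t)}. ennreal (C2 * B) \<partial>lborel)"
        using sub by (intro nn_integral_mono) (auto intro!: bound x t split: split_indicator)
      also have "\<dots> = ennreal (C2 * B) * ennreal (2 * exp (- \<delta> * \<alpha> t))" by (simp add: nn_integral_cmult)
      also have "\<dots> = ennreal (2 * exp (- \<delta> * \<alpha> t) * (C2 * B))"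
        using C2 B by (simp add: mult.commute flip: ennreal_mult)
      finally show "(\<integral>\<^sup>+s\<in>{s0 - exp (- \<delta> * \<alpha> t)..s0 + exp (- \<delta> * \<alpha> t)}. F x t s \<partial>lborel)
          \<le> ennreal (2 * exp (- \<delta> * \<alpha> t) * (C2 * B))" .
    qed
  qed
  have "sup_average G A c act g \<alpha> \<phi> \<delta> f x \<le> ennreal B'" if x: "f x \<le> ennreal M" for x
    unfolding sup_average_def
  proof (rule SUP_least, clarify)
    fix t s0 :: real assume t: "0 \<le> t" and sub: "(+) s0 ` short_interval \<delta> \<alpha> t \<subseteq> ?W"
    define l where "l = exp (- \<delta> * \<alpha> t)"
    have J: "(+) s0 ` short_interval \<delta> \<alpha> t = {s0 - l..s0 + l}" by (simp add: short_interval_def l_def)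
    have l: "l > 0" by (simp add: l_def)
    have "(\<integral>\<^sup>+s\<in>(+) s0 ` short_interval \<delta> \<alpha> t. f (act (g t \<otimes> ?E (\<phi> s)) x) \<partial>lborel) \<le> ennreal (2 * l * B')"
      using B'(2)[OF x t, of s0] sub unfolding J F_def l_def by blast
    then have "(\<integral>\<^sup>+s\<in>(+) s0 ` short_interval \<delta> \<alpha> t. f (act (g t \<otimes> ?E (\<phi> s)) x) \<partial>lborel)
        / emeasure lborel (short_interval \<delta> \<alpha> t) \<le> ennreal (2 * l * B') / ennreal (2 * l)"
      by (simp add: short_interval_def l_def divide_right_mono_ennreal)
    also have "\<dots> = ennreal B'" using l B'(1) by (simp add: divide_ennreal)
    finally show "(\<integral>\<^sup>+s\<in>(+) s0 ` short_interval \<delta> \<alpha> t. f (act (g t \<otimes> ?E (\<phi> s)) x) \<partial>lborel)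
        / emeasure lborel (short_interval \<delta> \<alpha> t) \<le> ennreal B'" .
  qed
  then show ?thesis by blast
qed

end

theorem proposition6p1:
  fixes G :: "'g::{t2_space, second_countable_topology} monoid"
    and A :: "('g, 'e::euclidean_space) chart set"
    and c :: "('g, 'e) chart"
    and act :: "'g \<Rightarrow> 'x::metric_space \<Rightarrow> 'x"
    and g :: "real \<Rightarrow> 'g"
    and \<alpha> :: "real \<Rightarrow> real"
    and \<phi> :: "real \<Rightarrow> 'e"
    and f :: "'x \<Rightarrow> ennreal"
    and \<beta> \<delta> :: real
  assumes "lie_group G A" and "connected (UNIV :: 'g set)"
    and "c \<in> A" and "\<one>\<^bsub>G\<^esub> \<in> chart_dom c"
    and "continuous_action G act"
    and "one_parameter_subgroup G g" and "\<exists>t. g t \<noteq> \<one>\<^bsub>G\<^esub>"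
    and "Ad_diagonalizable G c g"
    and "admissible G c g \<alpha> \<phi>"
    and "height_function G A c act g \<alpha> \<phi> \<beta> f"
    and "0 \<le> \<delta>" and "\<delta> < \<beta>"
  shows "(\<forall>x0. f x0 < \<infinity> \<longrightarrow> sup_average G A c act g \<alpha> \<phi> \<delta> f x0 < \<infinity>) \<and>
    (\<forall>M::real. M > 0 \<longrightarrow>
      (SUP x0\<in>{x. f x \<le> ennreal M}. sup_average G A c act g \<alpha> \<phi> \<delta> f x0) < \<infinity>)"
proof -
  interpret lie_group_chart G A c
    using assms(1,3,4) by (simp add: lie_group_chart_def lie_group_chart_axioms_def)
  note bounded = sup_average_bounded[OF assms(5,6,9,10,11,12)]
  show ?thesis
  proof (intro conjI allI impI)
    fix x0 assume "f x0 < \<infinity>"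
    \<comment> \<open>A finite value of \<open>f\<close> serves as its own threshold
      \<open>M\<close>, so the pointwise claim follows from the uniform bound.\<close>
    then have "f x0 \<le> ennreal (enn2real (f x0))" by simp
    with bounded[OF enn2real_nonneg] obtain B where
      "sup_average G A c act g \<alpha> \<phi> \<delta> f x0 \<le> ennreal B" by blast
    then show "sup_average G A c act g \<alpha> \<phi> \<delta> f x0 < \<infinity>"
      using ennreal_less_top by (simp add: order_le_less_trans)
  next
    fix M :: real assume "M > 0"
    with bounded[of M] obtain B where
      B: "\<And>x. f x \<le> ennreal M \<Longrightarrow> sup_average G A c act g \<alpha> \<phi> \<delta> f x \<le> ennreal B" by auto
    have "(SUP x0\<in>{x. f x \<le> ennreal M}. sup_average G A c act g \<alpha> \<phi> \<delta> f x0) \<le> ennreal B"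
      by (rule SUP_least) (simp add: B)
    then show "(SUP x0\<in>{x. f x \<le> ennreal M}. sup_average G A c act g \<alpha> \<phi> \<delta> f x0) < \<infinity>"
      using ennreal_less_top by (simp add: order_le_less_trans)
  qed
qed

end
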